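(* There exist absolute constants $c_0>0$ and $C_0>0$ such that the following holds. Let $k$ and $n$ be positive integers with $n>(k-1)^2$. Then every sequence $A=(a_1,\dots,a_n)$ of $n$ distinct real numbers contains a block-monotone subsequence of depth $k$ and block-size $s$ for some integer $s\ge c_0\, n/k^2$. Furthermore, there is an algorithm that, given $k$ and $A$, computes such a subsequence within time $C_0\, n^2\log (n+1)$.
   Context: A subsequence need not consist of consecutive entries. A sequence $(a_1,a_2,\dots,a_{ks})$ of $ks$ distinct real numbers ($k,s$ positive integers) is \emph{block-increasing} (resp. \emph{block-decreasing}) with \emph{depth} $k$ and \emph{block-size} $s$ if every subsequence $(a_{i_1},a_{i_2},\dots,a_{i_k})$ with $(j-1)s<i_j\le js$ for each $j=1,\dots,k$ is increasing (resp. decreasing). A sequence is \emph{block-monotone} if it is block-increasing or block-decreasing. Running time is measured in the usual RAM model in which comparing two real numbers and elementary operations on indices take constant time. *)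

theory Defs
  imports Complex_Main "HOL-Library.Sublist"
begin

section \<open>Block-monotone sequences\<close>

text \<open>
  Sequences are lists, so positions start at 0: the \<open>j\<close>-th block (\<open>j < k\<close>) consists of the
  positions \<open>j * s, \<dots>, (j + 1) * s - 1\<close>.  The function \<open>i\<close> selects one position per block; its
  values at arguments \<open>\<ge> k\<close> are irrelevant.
\<close>

definition block_increasing :: "nat \<Rightarrow> nat \<Rightarrow> real list \<Rightarrow> bool" where
  "block_increasing k s a \<longleftrightarrow>
     0 < k \<and> 0 < s \<and> length a = k * s \<and> distinct a \<and>
     (\<forall>i :: nat \<Rightarrow> nat. (\<forall>j<k. j * s \<le> i j \<and> i j < (j + 1) * s) \<longrightarrow>
        sorted_wrt (<) (map (\<lambda>j. a ! i j) [0..<k]))"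

definition block_decreasing :: "nat \<Rightarrow> nat \<Rightarrow> real list \<Rightarrow> bool" where
  "block_decreasing k s a \<longleftrightarrow>
     0 < k \<and> 0 < s \<and> length a = k * s \<and> distinct a \<and>
     (\<forall>i :: nat \<Rightarrow> nat. (\<forall>j<k. j * s \<le> i j \<and> i j < (j + 1) * s) \<longrightarrow>
        sorted_wrt (>) (map (\<lambda>j. a ! i j) [0..<k]))"

definition block_monotone :: "nat \<Rightarrow> nat \<Rightarrow> real list \<Rightarrow> bool" where
  "block_monotone k s a \<longleftrightarrow> block_increasing k s a \<or> block_decreasing k s a"


section \<open>A random access machine\<close>

text \<open>
  Unit-cost RAM with a memory of natural numbers (cells \<open>X 0, X 1, \<dots>\<close>), indirect addressing,
  a read-only array \<open>A\<close> of real numbers, and a write-only output sequence of entries of \<open>A\<close>.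
  The only access to the real numbers is to compare two entries of \<open>A\<close> and to output one.

  The machine has a word bound \<open>W\<close>: writing a number larger than \<open>W\<close> to memory is an error.
  Without it, unit-cost multiplication would make the machine unrealistically strong.
\<close>

datatype instr =
    Const nat nat          \<comment> \<open>\<open>X r := c\<close>\<close>
  | Move nat nat           \<comment> \<open>\<open>X r := X a\<close>\<close>
  | Add nat nat nat        \<comment> \<open>\<open>X r := X a + X b\<close>\<close>
  | Sub nat nat nat        \<comment> \<open>\<open>X r := X a - X b\<close>, truncated at 0\<close>
  | Mul nat nat nat        \<comment> \<open>\<open>X r := X a * X b\<close>\<close>
  | Div nat nat nat        \<comment> \<open>\<open>X r := X a div X b\<close>, an error if \<open>X b = 0\<close>\<close>
  | Load nat nat           \<comment> \<open>\<open>X r := X (X a)\<close>\<close>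
  | Store nat nat          \<comment> \<open>\<open>X (X r) := X a\<close>\<close>
  | Jump nat               \<comment> \<open>\<open>goto l\<close>\<close>
  | Jump_Less nat nat nat  \<comment> \<open>\<open>if X a < X b goto l\<close>\<close>
  | Jump_Less_Real nat nat nat
                           \<comment> \<open>\<open>if A ! X a < A ! X b goto l\<close>, an error if out of range\<close>
  | Output nat             \<comment> \<open>append \<open>A ! X a\<close> to the output, an error if out of range\<close>
  | Halt

text \<open>Program counter, memory, output produced so far.\<close>

type_synonym config = "nat \<times> (nat \<Rightarrow> nat) \<times> real list"

definition write_cell :: "nat \<Rightarrow> config \<Rightarrow> nat \<Rightarrow> nat \<Rightarrow> config option" where
  "write_cell W c r v = (case c of (pc, X, out) \<Rightarrow>
     if v \<le> W then Some (Suc pc, X(r := v), out) else None)"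

text \<open>\<^const>\<open>None\<close> means that no step is possible: the machine has halted or an error has occurred.\<close>

definition step :: "nat \<Rightarrow> real list \<Rightarrow> instr list \<Rightarrow> config \<Rightarrow> config option" where
  "step W A P c = (case c of (pc, X, out) \<Rightarrow>
     if pc < length P then
       (case P ! pc of
          Const r v \<Rightarrow> write_cell W c r v
        | Move r a \<Rightarrow> write_cell W c r (X a)
        | Add r a b \<Rightarrow> write_cell W c r (X a + X b)
        | Sub r a b \<Rightarrow> write_cell W c r (X a - X b)
        | Mul r a b \<Rightarrow> write_cell W c r (X a * X b)
        | Div r a b \<Rightarrow> if X b = 0 then None else write_cell W c r (X a div X b)
        | Load r a \<Rightarrow> write_cell W c r (X (X a))
        | Store r a \<Rightarrow> write_cell W c (X r) (X a)
        | Jump l \<Rightarrow> Some (l, X, out)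
        | Jump_Less a b l \<Rightarrow> Some (if X a < X b then l else Suc pc, X, out)
        | Jump_Less_Real a b l \<Rightarrow>
            if X a < length A \<and> X b < length A
            then Some (if A ! X a < A ! X b then l else Suc pc, X, out) else None
        | Output a \<Rightarrow>
            if X a < length A then Some (Suc pc, X, out @ [A ! X a]) else None
        | Halt \<Rightarrow> None)
     else None)"

fun steps :: "nat \<Rightarrow> real list \<Rightarrow> instr list \<Rightarrow> nat \<Rightarrow> config \<Rightarrow> config option" where
  "steps W A P 0 c = Some c"
| "steps W A P (Suc t) c = Option.bind (step W A P c) (steps W A P t)"

definition halted :: "instr list \<Rightarrow> config \<Rightarrow> bool" where
  "halted P c \<longleftrightarrow> fst c < length P \<and> P ! fst c = Halt"

text \<open>Cell 0 contains the length of \<open>A\<close>, cell 1 contains \<open>k\<close>, all other cells contain 0.\<close>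

definition initial_config :: "nat \<Rightarrow> real list \<Rightarrow> config" where
  "initial_config k A = (0, (\<lambda>_. 0)(0 := length A, 1 := k), [])"

text \<open>
  On input \<open>k\<close> and \<open>A\<close>, the program \<open>P\<close> halts without error with output \<open>B\<close> after at most \<open>T\<close>
  steps, using words of \<open>O(log n)\<close> bits, namely numbers up to \<open>(n + 1) ^ w\<close>, where \<open>n\<close> is the
  length of \<open>A\<close>.
\<close>

definition computes_within :: "instr list \<Rightarrow> nat \<Rightarrow> nat \<Rightarrow> real list \<Rightarrow> real list \<Rightarrow> real \<Rightarrow> bool" where
  "computes_within P w k A B T \<longleftrightarrow>
     (\<exists>t pc X. real t \<le> T \<and>
        steps ((length A + 1) ^ w) A P t (initial_config k A) = Some (pc, X, B) \<and>
        halted P (pc, X, B))"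

end

theory Submission
  imports Defs
begin

text \<open>
  Put \<open>s = n div (10 * k\<^sup>2) + 1\<close> and call \<open>i < j\<close> an increasing (decreasing) good pair if
  \<open>A ! i < A ! j\<close> (\<open>A ! i > A ! j\<close>) and at least \<open>s - 1\<close> points of the graph of \<open>A\<close> lie inside the
  rectangle spanned by the points \<open>i\<close> and \<open>j\<close>.  A path of \<open>k\<close> good pairs of one kind gives a
  block-monotone subsequence: each block consists of the starting point of a pair and of \<open>s - 1\<close>
  points inside its rectangle.  If there are no such paths, label every index with the lengths of
  the longest increasing and decreasing good paths starting there.  This gives at most \<open>k\<^sup>2\<close> classes,
  and two indices with equal labels do not form a good pair.  But the rectangles
  spanned by the leftmost, rightmost, lowest and highest points of a class cover the class,
  and five of them suffice, so a class of at least \<open>n / k\<^sup>2\<close> points contains a good pair.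
  For \<open>s = 1\<close> every pair is good and the labels start at 1 (a single index is a block), so that
  \<open>(k - 1)\<^sup>2 < n\<close> suffices for a contradiction.

  The labels are computed from right to left by dynamic programming; a table of the numbers
  \<open>card {l. l < j \<and> A ! l < A ! v}\<close> makes it possible to count the points in a rectangle in constant
  time, so that the algorithm takes time \<open>O(n\<^sup>2)\<close>.
\<close>

section \<open>Good pairs and chains of blocks\<close>

text \<open>The flag \<open>d\<close> selects increasing (\<^const>\<open>True\<close>) or decreasing (\<^const>\<open>False\<close>) order.\<close>

definition before :: "bool \<Rightarrow> real \<Rightarrow> real \<Rightarrow> bool" where
  "before d u v \<longleftrightarrow> (if d then u < v else v < u)"

definition inside :: "bool \<Rightarrow> real list \<Rightarrow> nat \<Rightarrow> nat \<Rightarrow> nat \<Rightarrow> bool" where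
  "inside d A i j l \<longleftrightarrow> i < l \<and> l < j \<and> before d (A ! i) (A ! l) \<and> before d (A ! l) (A ! j)"

definition good :: "bool \<Rightarrow> real list \<Rightarrow> nat \<Rightarrow> nat \<Rightarrow> nat \<Rightarrow> bool" where
  "good d A s i j \<longleftrightarrow> i < j \<and> j < length A \<and> before d (A ! i) (A ! j) \<and>
     s \<le> card {l. inside d A i j l} + 1"

section \<open>Pigeonhole argument for large labels\<close>

text \<open>A pair that is not good has at most \<open>s - 2\<close> points inside its rectangle.
  Four extremal points and five rectangles therefore account for at most
  \<open>4 + 5 * (s - 2) = 5 * s - 6\<close> points.\<close>

lemma extremal_boxes_cover:
  fixes A :: "real list"
  assumes S: "S \<subseteq> {..<length A}" "S \<noteq> {}" and A: "distinct A"
    and bad: "\<And>i j d. i \<in> S \<Longrightarrow> j \<in> S \<Longrightarrow> \<not> good d A s i j"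
    and s: "s \<ge> 2"
  shows "card S + 6 \<le> 5 * s"
proof -
  have fin: "finite S" using S(1) finite_subset by blast
  \<comment> \<open>The union over all four orientations makes \<open>box\<close> symmetric, so the
    relative position of the two corners need not be known. At most one of the four parts is
    nonempty.\<close>
  define box where "box p q = {l. inside True A p q l \<or> inside False A p q l \<or>
    inside True A q p l \<or> inside False A q p l}" for p q
  have box: "finite (box p q) \<and> card (box p q) \<le> s - 2" if pq: "p \<in> S" "q \<in> S" for p q
  proof -
    have *: "finite (box p q) \<and> card (box p q) \<le> s - 2" if pq: "p \<in> S" "q \<in> S" "p < q" for p q
    proof -
      have lt: "q < length A" "p < length A" using pq S by auto
      with A pq have "A ! p \<noteq> A ! q" by (simp add: nth_eq_iff_index_eq)
      then obtain d where d: "before d (A ! p) (A ! q)"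
        by (metis before_def linorder_neqE)
      have e: "box p q = {l. inside d A p q l}"
        using d pq(3) by (cases d) (auto simp: box_def inside_def before_def)
      have "{l. inside d A p q l} \<subseteq> {..<q}" by (auto simp: inside_def)
      then have "finite (box p q)" using e finite_subset by fastforce
      moreover have "card (box p q) \<le> s - 2"
        using bad[OF pq(1,2), of d] d lt pq(3) s unfolding good_def e by auto
      ultimately show ?thesis by blast
    qed
    have sym: "box p q = box q p" by (auto simp: box_def)
    show ?thesis
    proof (cases p q rule: linorder_cases)
      case equal
      then have "box p q = {}" by (auto simp: box_def inside_def)
      then show ?thesis by simp
    next
      case less
      then show ?thesis by (rule *[OF pq])
    next
      case greater
      then show ?thesis using *[OF pq(2,1)] sym by metis
    qed
  qed
  define l where "l = Min S"
  define r where "r = Max S"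
  obtain b where b: "b \<in> S" "\<And>x. x \<in> S \<Longrightarrow> A ! b \<le> A ! x"
    using fin S(2) by (metis arg_min_if_finite(1) arg_min_least)
  obtain t where t: "t \<in> S" "\<And>x. x \<in> S \<Longrightarrow> A ! x \<le> A ! t"
  proof -
    have "Max ((!) A ` S) \<in> (!) A ` S" using fin S(2) by (intro Max_in) auto
    then obtain t where "t \<in> S" "A ! t = Max ((!) A ` S)" by auto
    then show ?thesis using that fin by auto
  qed
  have lr: "l \<in> S" "r \<in> S" "\<And>x. x \<in> S \<Longrightarrow> l \<le> x \<and> x \<le> r"
    using fin S(2) by (auto simp: l_def r_def)
  have inj: "A ! x \<noteq> A ! y" if "x \<in> S" "y \<in> S" "x \<noteq> y" for x y
    using that S A by (metis lessThan_iff nth_eq_iff_index_eq subsetD)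
  \<comment> \<open>Points between the heights of \<open>l\<close> and \<open>r\<close> lie in \<open>box l r\<close>; those above (below) both heights
      lie in a box at \<open>t\<close> (\<open>b\<close>).\<close>
  let ?U = "{l, r, b, t} \<union> (box l r \<union> (box l t \<union> (box t r \<union> (box l b \<union> box b r))))"
  have "S \<subseteq> ?U"
  proof
    fix x assume x: "x \<in> S"
    show "x \<in> ?U"
    proof (cases "x \<in> {l, r, b, t}")
      case False
      have 1: "l < x" "x < r" using lr(3)[OF x] False by auto
      have 2: "A ! b < A ! x" "A ! x < A ! t"
        using b(2)[OF x] t(2)[OF x] inj[OF x b(1)] inj[OF x t(1)] False by auto
      have 3: "x \<noteq> t" "x \<noteq> b" "A ! x \<noteq> A ! l" "A ! x \<noteq> A ! r"
        using inj[OF x] lr False by auto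
      show ?thesis using 1 2 3
        unfolding box_def inside_def before_def by (auto; linarith)
    qed auto
  qed
  moreover have fU: "finite ?U" using box lr b t by auto
  ultimately have "card S \<le> card ?U" by (rule card_mono[rotated])
  also have "\<dots> \<le> card {l, r, b, t} + (card (box l r) + (card (box l t) + (card (box t r) + (card (box l b) + card (box b r)))))"
    by (intro order_trans[OF card_Un_le] add_mono order_refl)
  also have "\<dots> \<le> 4 + ((s - 2) + ((s - 2) + ((s - 2) + ((s - 2) + (s - 2)))))"
    using box lr(1,2) b(1) t(1) by (intro add_mono) (auto simp: card_insert_if)
  finally show ?thesis using s by simp
qed

text \<open>The labels are kept abstract so that the values found by the program can be inserted
  later. By \<open>less\<close>, two indices with the same pair of labels never form a good
  pair.\<close>

lemma exists_large_label:
  fixes A :: "real list" and x :: "bool \<Rightarrow> nat \<Rightarrow> nat"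
  assumes A: "distinct A" and k: "0 < k" "(k - 1)\<^sup>2 < length A"
    and s: "s = length A div (10 * k\<^sup>2) + 1"
    and base: "\<And>d i. i < length A \<Longrightarrow> s = 1 \<Longrightarrow> 1 \<le> x d i"
    and less: "\<And>d i j. good d A s i j \<Longrightarrow> x d j < x d i"
  shows "\<exists>d i. i < length A \<and> k \<le> x d i"
proof (rule ccontr)
  assume "\<not> ?thesis"
  then have lt: "\<And>d i. i < length A \<Longrightarrow> x d i < k" by (meson not_le)
  define f where "f i = (x True i, x False i)" for i
  have bad: "\<not> good d A s i j" if "f i = f j" for i j d
    using less[of d i j] that by (cases d) (auto simp: f_def)
  show False
  proof (cases "s = 1")
    case True
    \<comment> \<open>Labels start at 1 here, so only \<open>k - 1\<close> values remain for each of
      the two labels; this is where \<open>(k - 1)\<^sup>2 < length A\<close> suffices.\<close>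
    have "f ` {..<length A} \<subseteq> {1..<k} \<times> {1..<k}"
      using base[OF _ True] lt by (auto simp: f_def)
    then have "card (f ` {..<length A}) \<le> card ({1..<k} \<times> {1..<k})"
      by (intro card_mono) auto
    then have "card (f ` {..<length A}) < card {..<length A}"
      using k(2) by (simp add: card_cartesian_product power2_eq_square)
    then have "\<not> inj_on f {..<length A}" by (rule pigeonhole)
    then obtain i j where ij: "i < j" "j < length A" "f i = f j"
      unfolding inj_on_def by (metis lessThan_iff linorder_neqE)
    then have "A ! i \<noteq> A ! j" using A by (simp add: nth_eq_iff_index_eq)
    then obtain d where "before d (A ! i) (A ! j)" by (metis before_def linorder_neqE)
    then have "good d A s i j" using ij True by (simp add: good_def)
    with bad ij(3) show False by blast
  next
    case False
    have s2: "s \<ge> 2" using s False by auto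
    define S where "S c = {i. i < length A \<and> f i = c}" for c
    let ?K = "{..<k} \<times> {..<k}"
    have cS: "card (S c) + 6 \<le> 5 * s" for c
    proof (cases "S c = {}")
      case True then show ?thesis using s2 by simp
    next
      case False
      then show ?thesis
        by (intro extremal_boxes_cover[of _ A]) (use A bad s2 in \<open>auto simp: S_def\<close>)
    qed
    have "{..<length A} \<subseteq> (\<Union>c\<in>?K. S c)" using lt by (auto simp: S_def f_def)
    then have "length A \<le> card (\<Union>c\<in>?K. S c)"
      using card_mono[of "\<Union>c\<in>?K. S c" "{..<length A}"] by (auto simp: S_def)
    also have "\<dots> \<le> (\<Sum>c\<in>?K. card (S c))" by (rule card_UN_le) simp
    also have "\<dots> \<le> (\<Sum>c\<in>?K. 5 * s - 6)" by (rule sum_mono) (metis cS add_le_imp_le_diff)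
    also have "\<dots> = k\<^sup>2 * (5 * s - 6)" by (simp add: card_cartesian_product power2_eq_square)
    \<comment> \<open>\<open>5 * s - 6 = 5 * (s - 1) - 1\<close>, so the factor 10 in the definition
      of \<open>s\<close> leaves slack.\<close>
    also have "\<dots> < k\<^sup>2 * (10 * (s - 1))" using k(1) s2 by simp
    also have "\<dots> = (10 * k\<^sup>2) * (length A div (10 * k\<^sup>2))" by (simp add: s)
    also have "\<dots> \<le> length A" by simp
    finally show False by simp
  qed
qed

section \<open>From paths of good pairs to block-monotone subsequences\<close>

text \<open>
  The last block of a chain is allowed to have no successor if \<open>s = 1\<close>; then the value of \<open>j\<close> is
  irrelevant.
\<close>

definition block :: "bool \<Rightarrow> real list \<Rightarrow> nat \<Rightarrow> nat \<Rightarrow> nat \<Rightarrow> nat list" where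
  "block d A s i j = i # take (s - 1) (filter (inside d A i j) [0..<length A])"

primrec blocks :: "bool \<Rightarrow> real list \<Rightarrow> nat \<Rightarrow> (nat \<Rightarrow> nat) \<Rightarrow> nat \<Rightarrow> nat \<Rightarrow> nat list list" where
  "blocks d A s nx i 0 = []"
| "blocks d A s nx i (Suc m) = block d A s i (nx i) # blocks d A s nx (nx i) m"

lemma length_blocks [simp]: "length (blocks d A s nx i m) = m"
  by (induction m arbitrary: i) auto

text \<open>The defining recursion peels off the first block, whereas the output loop appends the
  last one; its invariant needs this form.\<close>

lemma blocks_Suc: 
  "blocks d A s nx i (Suc m) = blocks d A s nx i m @ [block d A s ((nx ^^ m) i) (nx ((nx ^^ m) i))]"
  by (induction m arbitrary: i) (simp_all add: funpow_swap1)

text \<open>The blocks hold positions. Increasing positions make the concatenation a subsequence;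
  values are compared only between different blocks, as block-monotonicity leaves the order within a
  block free.\<close>

definition chain :: "bool \<Rightarrow> real list \<Rightarrow> nat \<Rightarrow> nat list list \<Rightarrow> bool" where
  "chain d A s bs \<longleftrightarrow> (\<forall>b\<in>set bs. length b = s \<and> set b \<subseteq> {..<length A}) \<and>
     sorted_wrt (<) (concat bs) \<and>
     sorted_wrt (\<lambda>b c. \<forall>u\<in>set b. \<forall>v\<in>set c. before d (A ! u) (A ! v)) bs"

lemma before_trans: "before d u v \<Longrightarrow> before d v w \<Longrightarrow> before d u w"
  by (auto simp: before_def split: if_splits)

lemma block_props:
  assumes "i < length A"
  shows "set (block d A s i j) \<subseteq> insert i {l. inside d A i j l}" 
    "set (block d A s i j) \<subseteq> {..<length A}" "sorted_wrt (<) (block d A s i j)"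
proof -
  show 1: "set (block d A s i j) \<subseteq> insert i {l. inside d A i j l}"
    and "set (block d A s i j) \<subseteq> {..<length A}"
    using assms by (auto simp: block_def dest!: in_set_takeD)
  have "sorted_wrt (<) (take (s - 1) (filter (inside d A i j) [0..<length A]))"
    by (intro sorted_wrt_take sorted_wrt_filter) simp
  moreover have "i < l" if "l \<in> set (take (s - 1) (filter (inside d A i j) [0..<length A]))" for l
    using in_set_takeD[OF that] by (auto simp: inside_def)
  ultimately show "sorted_wrt (<) (block d A s i j)" by (simp add: block_def)
qed

lemma length_block:
  assumes "good d A s i j" "s > 0"
  shows "length (block d A s i j) = s"
proof -
  have "{l. inside d A i j l} = set (filter (inside d A i j) [0..<length A])"
    using assms(1) by (auto simp: inside_def good_def)
  then have "card {l. inside d A i j l} = length (filter (inside d A i j) [0..<length A])"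
    by (metis distinct_card distinct_filter distinct_upt)
  then show ?thesis using assms by (auto simp: block_def good_def)
qed

text \<open>The block at \<open>i\<close> stays strictly before the corner \<open>nx i\<close> in
  position and in value, and by the second conjunct all later blocks lie weakly beyond that corner.
  That conjunct is there to carry the induction.\<close>

lemma chain_blocks:
  assumes s: "s > 0" and i: "i < length A" "m \<le> x i"
    and step: "\<And>i. i < length A \<Longrightarrow> x i = 0 \<or> (x i = 1 \<and> s = 1) \<or> (good d A s i (nx i) \<and> x i = Suc (x (nx i)))"
  shows "chain d A s (blocks d A s nx i m) \<and>
    (\<forall>u\<in>set (concat (blocks d A s nx i m)). u = i \<or> (i < u \<and> before d (A ! i) (A ! u)))"
  using i
proof (induction m arbitrary: i)
  case 0
  then show ?case by (simp add: chain_def)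
next
  case (Suc m)
  note bp = block_props[OF Suc.prems(1)]
  \<comment> \<open>The label is at least \<open>Suc m\<close>, hence nonzero. If it is 1 without a
    successor, then \<open>m = 0\<close>, and \<open>s = 1\<close> makes the index alone a full
    block.\<close>
  consider "m = 0" "s = 1" | "good d A s i (nx i)" "x i = Suc (x (nx i))"
    using step[OF Suc.prems(1)] Suc.prems(2) by linarith
  then show ?case
  proof cases
    case 1
    then show ?thesis using Suc.prems(1) by (simp add: chain_def block_def)
  next
    case 2
    let ?j = "nx i" and ?b = "block d A s i (nx i)"
    have j: "?j < length A" "m \<le> x ?j" "i < ?j" "before d (A ! i) (A ! ?j)"
      using 2 Suc.prems by (auto simp: good_def)
    note IH = Suc.IH[OF j(1,2)]
    have lb: "length ?b = s" using length_block 2 s by blast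
    have b: "u < ?j \<and> before d (A ! u) (A ! ?j) \<and> (u = i \<or> (i < u \<and> before d (A ! i) (A ! u)))"
      if "u \<in> set ?b" for u
      using that bp(1)[of d s ?j] j by (auto simp: inside_def)
    have c: "?j \<le> v \<and> (v = ?j \<or> before d (A ! ?j) (A ! v))" 
      if "v \<in> set (concat (blocks d A s nx ?j m))" for v
      using that IH by (metis less_imp_le order_refl)
    have bc: "u < v \<and> before d (A ! u) (A ! v)"
      if "u \<in> set ?b" "v \<in> set (concat (blocks d A s nx ?j m))" for u v
      using b[OF that(1)] c[OF that(2)] before_trans by (meson less_le_trans)
    have "chain d A s (?b # blocks d A s nx ?j m)"
      unfolding chain_def
    proof (intro conjI)
      show "\<forall>b\<in>set (?b # blocks d A s nx ?j m). length b = s \<and> set b \<subseteq> {..<length A}"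
        using lb bp(2)[of d s ?j] IH by (simp add: chain_def)
      show "sorted_wrt (<) (concat (?b # blocks d A s nx ?j m))"
        using bp(3)[of d s ?j] IH bc by (auto simp: chain_def sorted_wrt_append)
      show "sorted_wrt (\<lambda>b c. \<forall>u\<in>set b. \<forall>v\<in>set c. before d (A ! u) (A ! v)) (?b # blocks d A s nx ?j m)"
        using IH bc by (auto simp: chain_def)
    qed
    moreover have "u = i \<or> (i < u \<and> before d (A ! i) (A ! u))"
      if "u \<in> set (concat (?b # blocks d A s nx ?j m))" for u
      using that b c j before_trans by (auto; metis less_le_trans)
    ultimately show ?thesis by simp
  qed
qed

lemma subseq_map_nth:
  assumes "sorted_wrt (<) xs" "set xs \<subseteq> {..<length A}"
  shows "subseq (map ((!) A) xs) A"
proof -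
  have "subseq xs [0..<length A]"
  proof -
    \<comment> \<open>Both sides are sorted, distinct and have the same elements; a filtered list is
      a subsequence.\<close>
    have "xs = filter (\<lambda>i. i \<in> set xs) [0..<length A]"
    proof (rule sorted_distinct_set_unique)
      show "sorted xs" "distinct xs" using assms(1) by (auto simp: strict_sorted_iff)
      show "sorted (filter (\<lambda>i. i \<in> set xs) [0..<length A])"
        by (intro sorted_wrt_filter) simp
      show "set xs = set (filter (\<lambda>i. i \<in> set xs) [0..<length A])" using assms(2) by auto
    qed auto
    then show ?thesis by (metis subseq_filter_left)
  qed
  then have "subseq (map ((!) A) xs) (map ((!) A) [0..<length A])" by (rule subseq_map)
  then show ?thesis by (simp add: map_nth)
qed

lemma nth_concat_uniform:
  assumes "\<forall>b\<in>set bs. length b = s" "j < length bs" "q < s"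
  shows "concat bs ! (j * s + q) = bs ! j ! q"
  using assms
proof (induction bs arbitrary: j)
  case (Cons b bs)
  show ?case
  proof (cases j)
    case 0
    then show ?thesis using Cons.prems by (simp add: nth_append)
  next
    case (Suc i)
    then show ?thesis using Cons by (simp add: nth_append)
  qed
qed simp

lemma chain_block_monotone:
  assumes A: "distinct A" and s: "s > 0" and bs: "chain d A s bs" "bs \<noteq> []"
  defines "B \<equiv> map ((!) A) (concat bs)"
  shows "subseq B A" "block_monotone (length bs) s B"
proof -
  have len: "\<forall>b\<in>set bs. length b = s" using bs by (simp add: chain_def)
  have sorted: "sorted_wrt (<) (concat bs)" using bs by (simp add: chain_def)
  have range: "set (concat bs) \<subseteq> {..<length A}" using bs by (auto simp: chain_def)
  have lc: "length (concat bs) = length bs * s"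
    using len by (induction bs) auto
  show "subseq B A" unfolding B_def by (rule subseq_map_nth[OF sorted range])
  have dist: "distinct B"
    unfolding B_def distinct_map
  proof
    show "distinct (concat bs)" using sorted by (simp add: strict_sorted_iff)
    show "inj_on ((!) A) (set (concat bs))"
      using inj_on_nth[OF A] range by (meson inj_on_subset lessThan_iff subsetD subset_refl)
  qed
  have main: "sorted_wrt (before d) (map (\<lambda>j. B ! f j) [0..<length bs])"
    if f: "\<forall>j<length bs. j * s \<le> f j \<and> f j < (j + 1) * s" for f
  proof -
    have "before d (B ! f i) (B ! f j)" if "i < j" "j < length bs" for i j
    proof -
      have el: "\<exists>u \<in> set (bs ! i). B ! f i = A ! u" if "i < length bs" for i
      proof -
        \<comment> \<open>Offset of the selected position within block \<open>i\<close>, as required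
          by \<open>nth_concat_uniform\<close>.\<close>
        have q: "f i = i * s + (f i - i * s)" "f i - i * s < s" using f that by auto
        have "f i < length (concat bs)"
        proof -
          have "f i < (i + 1) * s" using f that by blast
          also have "\<dots> \<le> length bs * s" using that by (intro mult_le_mono1) simp
          finally show ?thesis by (simp add: lc)
        qed
        then have "B ! f i = A ! (concat bs ! f i)" by (simp add: B_def)
        also have "concat bs ! f i = bs ! i ! (f i - i * s)"
          using nth_concat_uniform[OF len that q(2)] q(1) by simp
        finally show ?thesis using len that q(2) by (metis nth_mem)
      qed
      have "\<forall>u\<in>set (bs ! i). \<forall>v\<in>set (bs ! j). before d (A ! u) (A ! v)"
        using bs(1) that by (simp add: chain_def sorted_wrt_iff_nth_less)
      then show ?thesis using el[of i] el[of j] that by fastforce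
    qed
    then show ?thesis by (simp add: sorted_wrt_iff_nth_less)
  qed
  have "length B = length bs * s" using lc by (simp add: B_def)
  then show "block_monotone (length bs) s B"
    using main dist s bs(2) unfolding block_monotone_def block_increasing_def block_decreasing_def before_def
    by (cases d) (auto simp: eta_contract_eq)
qed


section \<open>Structured programs for the random access machine\<close>

text \<open>
  Besides its registers, a structured program has a table of \<open>n + 3\<close> rows and \<open>n\<close> columns, where
  \<open>n\<close> is the length of the input.  Registers are the cells below \<^term>\<open>nregs\<close>, and the table entry
  \<open>(i, j)\<close> is the cell \<open>nregs + i * n + j\<close>.  Registers 0 to 3 contain \<open>n\<close>, \<open>k\<close>, \<open>1\<close> and \<^term>\<open>nregs\<close>;
  register 4 is used for address computations.
\<close>

definition nregs :: nat where "nregs = 32"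

text \<open>
  \<open>For r c\<close> executes \<open>c\<close> for \<open>r = 0, \<dots>, n - 1\<close> (it is compiled to a loop that tests at the end, so
  \<open>n > 0\<close> is needed).  As all loops have the same bound, the running time is bounded
  statically.
\<close>

datatype cmd =
    Skip
  | SetC nat nat
  | Copy nat nat
  | Plus nat nat nat
  | Minus nat nat nat
  | Times nat nat nat
  | Quot nat nat nat
  | Get nat nat nat
  | Put nat nat nat
  | Emit nat
  | Seq cmd cmd  (infixr \<open>;;\<close> 60)
  | If_Less nat nat cmd cmd
  | If_Less_Real nat nat cmd cmd
  | For nat cmd

section \<open>Compilation and static time bounds\<close>

fun len :: "cmd \<Rightarrow> nat" where
  "len Skip = 0"
| "len (Get r i j) = 4"
| "len (Put i j r) = 4"
| "len (c ;; d) = len c + len d"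
| "len (If_Less a b c d) = len c + len d + 2"
| "len (If_Less_Real a b c d) = len c + len d + 2"
| "len (For r c) = len c + 3"
| "len _ = 1"

text \<open>Jump targets are absolute, hence the start address \<open>p\<close>. The alternative
  \<open>d\<close> comes first because a conditional jump falls through when its test fails.\<close>

fun code :: "nat \<Rightarrow> cmd \<Rightarrow> instr list" where
  "code p Skip = []"
| "code p (SetC r v) = [Const r v]"
| "code p (Copy r a) = [Move r a]"
| "code p (Plus r a b) = [Add r a b]"
| "code p (Minus r a b) = [Sub r a b]"
| "code p (Times r a b) = [Mul r a b]"
| "code p (Quot r a b) = [Div r a b]"
| "code p (Get r i j) = [Mul 4 i 0, Add 4 4 j, Add 4 4 3, Load r 4]"
| "code p (Put i j r) = [Mul 4 i 0, Add 4 4 j, Add 4 4 3, Store 4 r]"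
| "code p (Emit r) = [Output r]"
| "code p (c ;; d) = code p c @ code (p + len c) d"
| "code p (If_Less a b c d) = Jump_Less a b (p + len d + 2) # code (p + 1) d @
     Jump (p + len d + 2 + len c) # code (p + len d + 2) c"
| "code p (If_Less_Real a b c d) = Jump_Less_Real a b (p + len d + 2) # code (p + 1) d @
     Jump (p + len d + 2 + len c) # code (p + len d + 2) c"
| "code p (For r c) = Const r 0 # code (p + 1) c @ [Add r r 2, Jump_Less r 0 (p + 1)]"

lemma length_code [simp]: "length (code p c) = len c"
  by (induction c arbitrary: p) auto

text \<open>An upper bound: both branches of a conditional are charged, so that the result depends
  on \<open>n\<close> alone.\<close>

fun time :: "nat \<Rightarrow> cmd \<Rightarrow> nat" where
  "time n Skip = 0"
| "time n (Get r i j) = 4"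
| "time n (Put i j r) = 4"
| "time n (c ;; d) = time n c + time n d"
| "time n (If_Less a b c d) = time n c + time n d + 2"
| "time n (If_Less_Real a b c d) = time n c + time n d + 2"
| "time n (For r c) = n * (time n c + 2) + 1"
| "time n _ = 1"

fun writes :: "cmd \<Rightarrow> nat set" where
  "writes (SetC r v) = {r}"
| "writes (Copy r a) = {r}"
| "writes (Plus r a b) = {r}"
| "writes (Minus r a b) = {r}"
| "writes (Times r a b) = {r}"
| "writes (Quot r a b) = {r}"
| "writes (Get r i j) = {r}"
| "writes (c ;; d) = writes c \<union> writes d"
| "writes (If_Less a b c d) = writes c \<union> writes d"
| "writes (If_Less_Real a b c d) = writes c \<union> writes d"
| "writes (For r c) = insert r (writes c)"
| "writes _ = {}"

definition readable :: "nat \<Rightarrow> bool" where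
  "readable r \<longleftrightarrow> r < nregs \<and> r \<noteq> 4"

definition writable :: "nat \<Rightarrow> bool" where
  "writable r \<longleftrightarrow> 4 < r \<and> r < nregs"

fun wf_cmd :: "cmd \<Rightarrow> bool" where
  "wf_cmd Skip = True"
| "wf_cmd (SetC r v) = writable r"
| "wf_cmd (Copy r a) = (writable r \<and> readable a)"
| "wf_cmd (Plus r a b) = (writable r \<and> readable a \<and> readable b)"
| "wf_cmd (Minus r a b) = (writable r \<and> readable a \<and> readable b)"
| "wf_cmd (Times r a b) = (writable r \<and> readable a \<and> readable b)"
| "wf_cmd (Quot r a b) = (writable r \<and> readable a \<and> readable b)"
| "wf_cmd (Get r i j) = (writable r \<and> readable i \<and> readable j)"
| "wf_cmd (Put i j r) = (readable r \<and> readable i \<and> readable j)"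
| "wf_cmd (Emit r) = readable r"
| "wf_cmd (c ;; d) = (wf_cmd c \<and> wf_cmd d)"
| "wf_cmd (If_Less a b c d) = (readable a \<and> readable b \<and> wf_cmd c \<and> wf_cmd d)"
| "wf_cmd (If_Less_Real a b c d) = (readable a \<and> readable b \<and> wf_cmd c \<and> wf_cmd d)"
| "wf_cmd (For r c) = (writable r \<and> r \<notin> writes c \<and> wf_cmd c)"

section \<open>Weakest preconditions\<close>

text \<open>Registers, table and output are separate arguments, so the memory layout matters only in
  the correctness proof of the compiler.\<close>

type_synonym assn = "(nat \<Rightarrow> nat) \<Rightarrow> (nat \<Rightarrow> nat \<Rightarrow> nat) \<Rightarrow> real list \<Rightarrow> bool"

text \<open>
  Only \<open>SetC\<close>, \<open>Plus\<close> and \<open>Times\<close> can exceed the word bound: the other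
  results are at most as large as a number already in memory.
\<close>

fun loop :: "(assn \<Rightarrow> assn) \<Rightarrow> nat \<Rightarrow> nat \<Rightarrow> nat \<Rightarrow> assn \<Rightarrow> assn" where
  "loop F r m 0 Q g t out = Q (g(r := m)) t out"
| "loop F r m (Suc d) Q g t out = F (loop F r (Suc m) d Q) (g(r := m)) t out"

text \<open>Total correctness: the extra conjuncts exclude machine errors and accesses outside the
  table.\<close>

fun wp :: "nat \<Rightarrow> real list \<Rightarrow> cmd \<Rightarrow> assn \<Rightarrow> assn" where
  "wp W A Skip Q g t out = Q g t out"
| "wp W A (SetC r v) Q g t out = (v \<le> W \<and> Q (g(r := v)) t out)"
| "wp W A (Copy r a) Q g t out = Q (g(r := g a)) t out"
| "wp W A (Plus r a b) Q g t out = (g a + g b \<le> W \<and> Q (g(r := g a + g b)) t out)"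
| "wp W A (Minus r a b) Q g t out = Q (g(r := g a - g b)) t out"
| "wp W A (Times r a b) Q g t out = (g a * g b \<le> W \<and> Q (g(r := g a * g b)) t out)"
| "wp W A (Quot r a b) Q g t out = (g b \<noteq> 0 \<and> Q (g(r := g a div g b)) t out)"
| "wp W A (Get r i j) Q g t out =
     (g i \<le> length A + 2 \<and> g j < length A \<and> Q (g(r := t (g i) (g j))) t out)"
| "wp W A (Put i j r) Q g t out =
     (g i \<le> length A + 2 \<and> g j < length A \<and> Q g (t(g i := (t (g i))(g j := g r))) out)"
| "wp W A (Emit r) Q g t out = (g r < length A \<and> Q g t (out @ [A ! g r]))"
| "wp W A (c ;; d) Q g t out = wp W A c (wp W A d Q) g t out"
| "wp W A (If_Less a b c d) Q g t out =
     (if g a < g b then wp W A c Q g t out else wp W A d Q g t out)"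
| "wp W A (If_Less_Real a b c d) Q g t out =
     (g a < length A \<and> g b < length A \<and>
      (if A ! g a < A ! g b then wp W A c Q g t out else wp W A d Q g t out))"
| "wp W A (For r c) Q g t out = loop (wp W A c) r 0 (length A) Q g t out"

lemma loop_mono:
  assumes "\<And>Q Q' g t out. F Q g t out \<Longrightarrow> (\<And>g t out. Q g t out \<Longrightarrow> Q' g t out) \<Longrightarrow> F Q' g t out"
    and "loop F r m d Q g t out" "\<And>g t out. Q g t out \<Longrightarrow> Q' g t out"
  shows "loop F r m d Q' g t out"
  using assms(2) by (induction d arbitrary: m g t out) (auto intro: assms(1,3))

lemma wp_mono:
  assumes "wp W A c Q g t out" "\<And>g t out. Q g t out \<Longrightarrow> Q' g t out"
  shows "wp W A c Q' g t out"
  using assms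
proof (induction c arbitrary: Q Q' g t out)
  case (Seq c d)
  from Seq.prems(1) have "wp W A c (wp W A d Q) g t out" by simp
  from Seq.IH(1)[OF this, of "wp W A d Q'"] Seq.IH(2)[OF _ Seq.prems(2)] show ?case by simp
next
  case (For r c)
  show ?case using loop_mono[of "wp W A c", OF For.IH] For.prems by auto
qed (auto split: if_splits)

lemma loop_frame:
  assumes mono: "\<And>Q Q' g t out. F Q g t out \<Longrightarrow> (\<And>g t out. Q g t out \<Longrightarrow> Q' g t out) \<Longrightarrow> F Q' g t out"
    and frame: "\<And>Q g t out. F Q g t out \<Longrightarrow>
      F (\<lambda>g' t' out'. Q g' t' out' \<and> (\<forall>x. x \<notin> V \<longrightarrow> g' x = g x)) g t out"
    and "loop F r m d Q g t out"
  shows "loop F r m d (\<lambda>g' t' out'. Q g' t' out' \<and> (\<forall>x. x \<notin> insert r V \<longrightarrow> g' x = g x)) g t out"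
  using assms(3)
proof (induction d arbitrary: m g t out)
  case (Suc d)
  from Suc.prems have "F (loop F r (Suc m) d Q) (g(r := m)) t out" by simp
  from frame[OF this] show ?case
    unfolding loop.simps
  proof (rule mono)
    fix g' t' out'
    assume *: "loop F r (Suc m) d Q g' t' out' \<and> (\<forall>x. x \<notin> V \<longrightarrow> g' x = (g(r := m)) x)"
    show "loop F r (Suc m) d (\<lambda>g' t' out'. Q g' t' out' \<and> (\<forall>x. x \<notin> insert r V \<longrightarrow> g' x = g x)) g' t' out'"
    proof (rule loop_mono[of F])
      show "loop F r (Suc m) d (\<lambda>g'' t'' out''. Q g'' t'' out'' \<and> (\<forall>x. x \<notin> insert r V \<longrightarrow> g'' x = g' x)) g' t' out'"
        using Suc.IH * by blast
    qed (use * in \<open>auto intro: mono\<close>)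
  qed
qed simp

text \<open>Thanks to this, invariants and postconditions can omit all registers that a command
  leaves alone.\<close>

lemma wp_frame:
  assumes "wp W A c Q g t out"
  shows "wp W A c (\<lambda>g' t' out'. Q g' t' out' \<and> (\<forall>x. x \<notin> writes c \<longrightarrow> g' x = g x)) g t out"
  using assms
proof (induction c arbitrary: Q g t out)
  case (Seq c d)
  from Seq.prems have "wp W A c (wp W A d Q) g t out" by simp
  from Seq.IH(1)[OF this] have "wp W A c (wp W A d (\<lambda>g' t' out'. Q g' t' out' \<and> 
      (\<forall>x. x \<notin> writes (c ;; d) \<longrightarrow> g' x = g x))) g t out"
    by (rule wp_mono) (rule wp_mono[OF Seq.IH(2)], auto)
  then show ?case by simp
next
  case (If_Less a b c d)
  show ?case using If_Less.prems
    by (auto split: if_splits intro: wp_mono[OF If_Less.IH(1)] wp_mono[OF If_Less.IH(2)])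
next
  case (If_Less_Real a b c d)
  show ?case using If_Less_Real.prems
    by (auto split: if_splits intro: wp_mono[OF If_Less_Real.IH(1)] wp_mono[OF If_Less_Real.IH(2)])
next
  case (For r c)
  have "loop (wp W A c) r 0 (length A) Q g t out" using For.prems by simp
  from loop_frame[OF wp_mono For.IH this] show ?case by simp
qed auto

text \<open>The invariant describes the state before the counter is set to \<open>m\<close>, so it
  says nothing useful about \<open>r\<close>. Untouched registers are always compared with the state
  at loop entry.\<close>

lemma wp_For:
  assumes init: "I 0 g t out"
    and body: "\<And>m g' t' out'. m < length A \<Longrightarrow> I m g' t' out' \<Longrightarrow>
      (\<And>x. x \<notin> insert r (writes c) \<Longrightarrow> g' x = g x) \<Longrightarrow>
      wp W A c (I (Suc m)) (g'(r := m)) t' out'"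
    and post: "\<And>g' t' out'. I (length A) g' t' out' \<Longrightarrow>
      (\<And>x. x \<notin> insert r (writes c) \<Longrightarrow> g' x = g x) \<Longrightarrow> Q (g'(r := length A)) t' out'"
  shows "wp W A (For r c) Q g t out"
proof -
  have "loop (wp W A c) r m d Q g' t' out'"
    if "m + d = length A" "I m g' t' out'" "\<And>x. x \<notin> insert r (writes c) \<Longrightarrow> g' x = g x"
    for m d g' t' out'
    using that
  proof (induction d arbitrary: m g' t' out')
    case 0
    then show ?case using post by simp
  next
    case (Suc d)
    have "wp W A c (I (Suc m)) (g'(r := m)) t' out'"
      by (rule body) (use Suc.prems in auto)
    from wp_frame[OF this] show ?case
      unfolding loop.simps by (rule wp_mono) (rule Suc.IH, use Suc.prems in auto)
  qed
  from this[of 0 "length A"] init show ?thesis by simp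
qed

section \<open>Time-bounded executions of the machine\<close>

definition reach :: "nat \<Rightarrow> real list \<Rightarrow> instr list \<Rightarrow> nat \<Rightarrow> (config \<Rightarrow> bool) \<Rightarrow> config \<Rightarrow> bool" where
  "reach W A P T Q c \<longleftrightarrow> (\<exists>t c'. t \<le> T \<and> steps W A P t c = Some c' \<and> Q c')"

lemma reach_refl: "Q c \<Longrightarrow> reach W A P T Q c"
  unfolding reach_def by (rule exI[of _ 0]) auto

lemma steps_add: "steps W A P (t + u) c = Option.bind (steps W A P t c) (steps W A P u)"
  by (induction t arbitrary: c) (auto split: Option.bind_splits)

lemma reach_trans:
  assumes "reach W A P T Q c" "\<And>c'. Q c' \<Longrightarrow> reach W A P T' Q' c'"
  shows "reach W A P (T + T') Q' c"
proof -
  obtain t c' where 1: "t \<le> T" "steps W A P t c = Some c'" "Q c'"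
    using assms(1) unfolding reach_def by blast
  obtain u c'' where 2: "u \<le> T'" "steps W A P u c' = Some c''" "Q' c''"
    using assms(2)[OF 1(3)] unfolding reach_def by blast
  show ?thesis unfolding reach_def
    by (rule exI[of _ "t + u"]) (use 1 2 in \<open>auto simp: steps_add\<close>)
qed

lemma reach_weaken:
  assumes "reach W A P T Q c" "T \<le> T'" "\<And>c'. Q c' \<Longrightarrow> Q' c'"
  shows "reach W A P T' Q' c"
  using assms unfolding reach_def by (meson order_trans)

lemma reach_step:
  assumes "step W A P c = Some c'" "reach W A P T Q c'"
  shows "reach W A P (Suc T) Q c"
proof -
  obtain u c'' where "u \<le> T" "steps W A P u c' = Some c''" "Q c''"
    using assms(2) unfolding reach_def by blast
  then show ?thesis unfolding reach_def
    by (intro exI[of _ "Suc u"]) (use assms(1) in auto)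
qed

definition code_at :: "instr list \<Rightarrow> nat \<Rightarrow> instr list \<Rightarrow> bool" where
  "code_at P p is \<longleftrightarrow> (\<exists>xs ys. P = xs @ is @ ys \<and> length xs = p)"

lemma code_at_append: 
  assumes "code_at P p (xs @ ys)"
  shows "code_at P p xs" "code_at P (p + length xs) ys"
proof -
  obtain us vs where *: "P = us @ (xs @ ys) @ vs" "length us = p"
    using assms unfolding code_at_def by blast
  show "code_at P p xs" unfolding code_at_def
    by (rule exI[of _ us], rule exI[of _ "ys @ vs"]) (use * in auto)
  show "code_at P (p + length xs) ys" unfolding code_at_def
    by (rule exI[of _ "us @ xs"], rule exI[of _ vs]) (use * in auto)
qed

lemma code_at_Cons: 
  assumes "code_at P p (x # ys)"
  shows "p < length P" "P ! p = x" "code_at P (Suc p) ys"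
proof -
  obtain us vs where *: "P = us @ (x # ys) @ vs" "length us = p"
    using assms unfolding code_at_def by blast
  then show "p < length P" "P ! p = x" by auto
  show "code_at P (Suc p) ys" using code_at_append(2)[of P p "[x]" ys] assms by simp
qed

section \<open>Correctness of the compilation\<close>

text \<open>Compiled code itself relies on the constants in registers 0, 2 and 3. Bounding every
  cell by \<open>W\<close> is what makes copies, differences, quotients and table accesses safe
  without a check.\<close>

definition corr :: "nat \<Rightarrow> nat \<Rightarrow> (nat \<Rightarrow> nat) \<Rightarrow> (nat \<Rightarrow> nat \<Rightarrow> nat) \<Rightarrow> (nat \<Rightarrow> nat) \<Rightarrow> bool" where
  "corr n W g t X \<longleftrightarrow> g 0 = n \<and> g 2 = 1 \<and> g 3 = nregs \<and> (\<forall>r. X r \<le> W) \<and>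
     (\<forall>r. readable r \<longrightarrow> X r = g r) \<and> (\<forall>i j. i \<le> n + 2 \<longrightarrow> j < n \<longrightarrow> X (nregs + i * n + j) = t i j)"

lemma corr_readable: "corr n W g t X \<Longrightarrow> readable r \<Longrightarrow> X r = g r"
  by (simp add: corr_def)

lemma corr_const: "corr n W g t X \<Longrightarrow> g 0 = n \<and> g 2 = 1 \<and> g 3 = nregs"
  by (simp add: corr_def)

lemma corr_upd: "corr n W g t X \<Longrightarrow> writable r \<Longrightarrow> v \<le> W \<Longrightarrow> corr n W (g(r := v)) t (X(r := v))"
  by (auto simp: corr_def writable_def nregs_def)

lemma corr_tmp: "corr n W g t X \<Longrightarrow> v \<le> W \<Longrightarrow> corr n W g t (X(4 := v))"
  by (auto simp: corr_def readable_def nregs_def)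

lemma corr_bound: "corr n W g t X \<Longrightarrow> X r \<le> W"
  by (simp add: corr_def)

text \<open>Uniqueness of quotient and remainder; hence a store into the table leaves all other
  entries alone.\<close>

lemma cell_inject:
  fixes n :: nat
  assumes "i * n + j = i' * n + j'" "j < n" "j' < n"
  shows "i = i' \<and> j = j'"
proof -
  have "(a * n + b) div n = a" if "b < n" for a b using that by auto
  from this[OF assms(2), of i] this[OF assms(3), of i'] assms(1) have "i = i'" by simp
  with assms(1) show ?thesis by simp
qed

lemma corr_put:
  assumes "corr n W g t X" "i \<le> n + 2" "j < n" "v \<le> W"
  shows "corr n W g (t(i := (t i)(j := v))) (X(nregs + i * n + j := v))"
  using assms cell_inject[of _ n _ i j] by (auto simp: corr_def readable_def)

definition post :: "nat \<Rightarrow> nat \<Rightarrow> assn \<Rightarrow> nat \<Rightarrow> config \<Rightarrow> bool" where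
  "post n W Q p c = (case c of (p', X, out) \<Rightarrow> p' = p \<and> (\<exists>g t. corr n W g t X \<and> Q g t out))"

lemma readable_simps [simp]: "readable 0" "readable (Suc 0)" "readable 2" "readable 3"
  by (auto simp: readable_def nregs_def)

text \<open>Handles the three address instructions that \<open>Get\<close> and \<open>Put\<close>
  share; \<open>x\<close> is the final access. Intermediate results stay below the size of the
  memory in use, which is at most \<open>W\<close>.\<close>

lemma reach_address:
  assumes "code_at P p ([Mul 4 i 0, Add 4 4 j, Add 4 4 3, x])" "corr (length A) W g t X"
    "readable i" "readable j" "g i \<le> length A + 2" "g j < length A"
    "nregs + (length A + 3) * length A \<le> W"
    "\<And>X'. corr (length A) W g t X' \<Longrightarrow> X' 4 = nregs + g i * length A + g j \<Longrightarrow>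
       code_at P (p + 3) [x] \<Longrightarrow> reach W A P T Q (p + 3, X', out)"
  shows "reach W A P (T + 3) Q (p, X, out)"
proof -
  note ca = code_at_Cons[OF assms(1)]
  note cb = code_at_Cons[OF ca(3)]
  note cc = code_at_Cons[OF cb(3)]
  let ?n = "length A"
  have le: "g i * ?n + g j \<le> (?n + 3) * ?n"
  proof -
    have "g i * ?n \<le> (?n + 2) * ?n" using assms(5) by (rule mult_le_mono1)
    then show ?thesis using assms(6) by (simp add: algebra_simps)
  qed
  have X: "X 0 = ?n" "X i = g i" "X j = g j" "X 3 = nregs" "j \<noteq> 4"
    using assms(3,4) corr_readable[OF assms(2)] corr_const[OF assms(2)] readable_simps
    by (auto simp: readable_def)
  define X1 where "X1 = X(4 := g i * ?n)"
  define X2 where "X2 = X1(4 := g i * ?n + g j)"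
  define X3 where "X3 = X2(4 := g i * ?n + g j + nregs)"
  have s1: "step W A P (p, X, out) = Some (p + 1, X1, out)"
    using ca X le assms(7) by (simp add: step_def write_cell_def X1_def)
  have s2: "step W A P (p + 1, X1, out) = Some (p + 2, X2, out)"
    using cb X le assms(7) by (simp add: step_def write_cell_def X2_def X1_def)
  have s3: "step W A P (p + 2, X2, out) = Some (p + 3, X3, out)"
    using cc X le assms(7) by (simp add: step_def write_cell_def X3_def X2_def X1_def)
  have "reach W A P T Q (p + 3, X3, out)"
  proof (rule assms(8))
    show "corr (length A) W g t X3"
      unfolding X1_def X2_def X3_def using le assms(7) by (intro corr_tmp assms(2)) auto
    show "code_at P (p + 3) [x]" using cc(3) by (simp add: numeral_3_eq_3)
  qed (simp add: X3_def)
  from reach_step[OF s1 reach_step[OF s2 reach_step[OF s3 this]]] show ?thesis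
    by (simp add: numeral_3_eq_3)
qed

lemma reach_step_post:
  assumes "step W A P c = Some c'" "post n W Q p c'" 
  shows "reach W A P (Suc 0) (post n W Q p) c"
  by (rule reach_step[OF assms(1)], rule reach_refl) (rule assms(2))

lemma reach_single:
  assumes "code_at P p [x]" "corr n W g t X'" "Q g t out'"
    and "p < length P \<Longrightarrow> P ! p = x \<Longrightarrow> step W A P (p, X, out) = Some (Suc p, X', out')"
  shows "reach W A P (Suc 0) (post n W Q (Suc p)) (p, X, out)"
  by (rule reach_step_post[OF assms(4)])
    (use assms(2,3) code_at_Cons[OF assms(1)] in \<open>auto simp: post_def\<close>)

lemma reach_write:
  assumes "code_at P p [x]" "corr n W g t X" "writable r" "v \<le> W" "Q (g(r := v)) t out"
    and "p < length P \<Longrightarrow> P ! p = x \<Longrightarrow> step W A P (p, X, out) = write_cell W (p, X, out) r v"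
  shows "reach W A P (Suc 0) (post n W Q (Suc p)) (p, X, out)"
  by (rule reach_single[OF assms(1) corr_upd[OF assms(2-4)]])
    (use assms(4-6) in \<open>auto simp: write_cell_def\<close>)

text \<open>Induction on \<open>c\<close>. Each command restores \<open>corr\<close> at its end
  address within its static time, so commands compose by \<open>reach_trans\<close>.\<close>

theorem code_correct:
  assumes A: "length A > 0" and W: "nregs + (length A + 3) * length A \<le> W"
  shows "wf_cmd c \<Longrightarrow> code_at P p (code p c) \<Longrightarrow> corr (length A) W g t X \<Longrightarrow>
    wp W A c Q g t out \<Longrightarrow>
    reach W A P (time (length A) c) (post (length A) W Q (p + len c)) (p, X, out)"
proof (induction c arbitrary: p g t X out Q)
  case Skip
  then show ?case by (intro reach_refl) (auto simp: post_def)
next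
  case (SetC r v)
  show ?case using SetC
    by (auto intro!: reach_write[where r = r and v = "v"] simp: step_def)
next
  case (Copy r a)
  have "X a = g a" "g a \<le> W"
    using Copy.prems corr_readable corr_bound by (auto, metis)
  then show ?case using Copy.prems
    by (auto intro!: reach_write[where r = r and v = "g a"] simp: step_def)
next
  case (Plus r a b)
  have "X a = g a" "X b = g b" using Plus.prems corr_readable by auto
  then show ?case using Plus.prems
    by (auto intro!: reach_write[where r = r and v = "g a + g b"] simp: step_def)
next
  case (Minus r a b)
  have "X a = g a" "X b = g b" "X a \<le> W" using Minus.prems corr_readable corr_bound by auto
  then show ?case using Minus.prems
    by (auto intro!: reach_write[where r = r and v = "g a - g b"] simp: step_def)
next
  case (Times r a b)
  have "X a = g a" "X b = g b" using Times.prems corr_readable by auto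
  then show ?case using Times.prems
    by (auto intro!: reach_write[where r = r and v = "g a * g b"] simp: step_def)
next
  case (Quot r a b)
  have "X a = g a" "X b = g b" "X a \<le> W" using Quot.prems corr_readable corr_bound by auto
  moreover from this have "X a div X b \<le> W" using div_le_dividend le_trans by blast
  ultimately show ?case using Quot.prems
    by (auto intro!: reach_write[where r = r and v = "g a div g b"] simp: step_def)
next
  case (Get r i j)
  have "reach W A P (1 + 3) (post (length A) W Q (p + len (Get r i j))) (p, X, out)"
  proof (rule reach_address[where x = "Load r 4" and i = i and j = j])
    fix X' assume X': "corr (length A) W g t X'" "X' 4 = nregs + g i * length A + g j"
      and x: "code_at P (p + 3) [Load r 4]"
    have "X' (X' 4) = t (g i) (g j)" using X' Get.prems by (auto simp: corr_def)
    moreover from this have "t (g i) (g j) \<le> W" using corr_bound[OF X'(1)] by metis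
    ultimately show "reach W A P 1 (post (length A) W Q (p + len (Get r i j))) (p + 3, X', out)"
      using Get.prems reach_write[OF x X'(1), where r = r and v = "t (g i) (g j)" and Q = Q]
      by (simp add: step_def eval_nat_numeral)
  qed (use Get.prems W in auto)
  then show ?case by simp
next
  case (Put i j r)
  have "reach W A P (1 + 3) (post (length A) W Q (p + len (Put i j r))) (p, X, out)"
  proof (rule reach_address[where x = "Store 4 r" and i = i and j = j])
    fix X' assume X': "corr (length A) W g t X'" "X' 4 = nregs + g i * length A + g j"
      and x: "code_at P (p + 3) [Store 4 r]"
    have "X' r = g r" "g r \<le> W"
      using Put.prems X'(1) corr_readable[OF X'(1)] corr_bound[OF X'(1), of r] by auto
    then show "reach W A P 1 (post (length A) W Q (p + len (Put i j r))) (p + 3, X', out)"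
      using Put.prems X'(2)
        reach_single[where n = "length A" and Q = Q and X = X' and out = out and out' = out and A = A, OF x corr_put[OF X'(1), of "g i" "g j" "g r"]]
      by (simp add: step_def write_cell_def eval_nat_numeral)
  qed (use Put.prems W in auto)
  then show ?case by simp
next
  case (Emit r)
  have "X r = g r" using Emit.prems corr_readable by auto
  then show ?case using Emit.prems
    by (auto intro!: reach_single[where X' = X] simp: step_def)
next
  case (Seq c d)
  have "reach W A P (time (length A) c) (post (length A) W (wp W A d Q) (p + len c)) (p, X, out)"
    using Seq.prems by (intro Seq.IH(1)) (auto dest: code_at_append)
  then have "reach W A P (time (length A) c + time (length A) d)
      (post (length A) W Q (p + len (c ;; d))) (p, X, out)"
  proof (rule reach_trans)
    fix c' assume "post (length A) W (wp W A d Q) (p + len c) c'"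
    then obtain g' t' X' out' where
      *: "c' = (p + len c, X', out')" "corr (length A) W g' t' X'" "wp W A d Q g' t' out'"
      unfolding post_def by (cases c') auto
    have "reach W A P (time (length A) d) (post (length A) W Q (p + len c + len d)) (p + len c, X', out')"
      using Seq.prems code_at_append(2)[of P p "code p c"] * by (intro Seq.IH(2)) auto
    then show "reach W A P (time (length A) d) (post (length A) W Q (p + len (c ;; d))) c'"
      by (simp add: * algebra_simps)
  qed
  then show ?case by simp
next
  case (If_Less a b c d)
  note ca = code_at_Cons[OF If_Less.prems(2)[unfolded code.simps]]
  note cb = code_at_append[OF ca(3)]
  note cc = code_at_Cons[OF cb(2)]
  have X: "X a = g a" "X b = g b" using If_Less.prems corr_readable by auto
  show ?case
  proof (cases "g a < g b")
    case True
    then have "step W A P (p, X, out) = Some (p + len d + 2, X, out)"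
      using ca X by (simp add: step_def)
    moreover have "reach W A P (time (length A) c) (post (length A) W Q (p + len d + 2 + len c))
        (p + len d + 2, X, out)"
      using If_Less.prems cc True by (intro If_Less.IH(1)) auto
    ultimately show ?thesis
      by (rule reach_weaken[OF reach_step]) (auto simp: ac_simps)
  next
    case False
    then have s: "step W A P (p, X, out) = Some (p + 1, X, out)"
      using ca X by (simp add: step_def)
    have "reach W A P (time (length A) d) (post (length A) W Q (p + 1 + len d)) (p + 1, X, out)"
      using If_Less.prems cb False by (intro If_Less.IH(2)) auto
    then have "reach W A P (time (length A) d + Suc 0) (post (length A) W Q (p + len d + 2 + len c)) (p + 1, X, out)"
    proof (rule reach_trans)
      fix c' assume "post (length A) W Q (p + 1 + len d) c'"
      then show "reach W A P (Suc 0) (post (length A) W Q (p + len d + 2 + len c)) c'"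
        using cc by (intro reach_step_post[where c' = "(p + len d + 2 + len c, snd c')"]) (auto simp: post_def step_def split: prod.splits)
    qed
    from reach_step[OF s this] show ?thesis
      by (rule reach_weaken) (auto simp: ac_simps)
  qed
next
  case (If_Less_Real a b c d)
  note ca = code_at_Cons[OF If_Less_Real.prems(2)[unfolded code.simps]]
  note cb = code_at_append[OF ca(3)]
  note cc = code_at_Cons[OF cb(2)]
  have X: "X a = g a" "X b = g b" using If_Less_Real.prems corr_readable by auto
  have bd: "g a < length A" "g b < length A" using If_Less_Real.prems by auto
  show ?case
  proof (cases "A ! g a < A ! g b")
    case True
    then have "step W A P (p, X, out) = Some (p + len d + 2, X, out)"
      using ca X bd by (simp add: step_def)
    moreover have "reach W A P (time (length A) c) (post (length A) W Q (p + len d + 2 + len c))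
        (p + len d + 2, X, out)"
      using If_Less_Real.prems cc True by (intro If_Less_Real.IH(1)) auto
    ultimately show ?thesis
      by (rule reach_weaken[OF reach_step]) (auto simp: ac_simps)
  next
    case False
    then have s: "step W A P (p, X, out) = Some (p + 1, X, out)"
      using ca X bd by (simp add: step_def)
    have "reach W A P (time (length A) d) (post (length A) W Q (p + 1 + len d)) (p + 1, X, out)"
      using If_Less_Real.prems cb False by (intro If_Less_Real.IH(2)) auto
    then have "reach W A P (time (length A) d + Suc 0) (post (length A) W Q (p + len d + 2 + len c)) (p + 1, X, out)"
    proof (rule reach_trans)
      fix c' assume "post (length A) W Q (p + 1 + len d) c'"
      then show "reach W A P (Suc 0) (post (length A) W Q (p + len d + 2 + len c)) c'"
        using cc by (intro reach_step_post[where c' = "(p + len d + 2 + len c, snd c')"]) (auto simp: post_def step_def split: prod.splits)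
    qed
    from reach_step[OF s this] show ?thesis
      by (rule reach_weaken) (auto simp: ac_simps)
  qed
next
  case (For r c)
  note ca = code_at_Cons[OF For.prems(2)[unfolded code.simps]]
  note cb = code_at_append[OF ca(3)]
  note cc = code_at_Cons[OF cb(2)]
  note cd = code_at_Cons[OF cc(3)]
  let ?n = "length A"
  have r: "writable r" "r \<notin> writes c" "wf_cmd c" using For.prems by auto
  have rr: "readable r" "r \<noteq> 0" "r \<noteq> 2" using r(1) by (auto simp: readable_def writable_def)
  have bod: "code_at P (Suc p) (code (Suc p) c)" using cb(1) by simp
  \<comment> \<open>Inner induction on the remaining rounds, entered at the loop body with the
    counter already set. The base case is one round, because the test follows the body.\<close>
  have iter: "reach W A P (Suc d * (time ?n c + 2)) (post ?n W Q (p + len (For r c))) (Suc p, X, out)"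
    if "m + Suc d = ?n" "corr ?n W (g(r := m)) t X" "loop (wp W A c) r m (Suc d) Q g t out"
    for m d g t X out
    using that
  proof (induction d arbitrary: m g t X out)
    case IH: (0 m g t X out)
    have "wp W A c (loop (wp W A c) r (Suc m) 0 Q) (g(r := m)) t out" using IH by simp
    \<comment> \<open>The frame property is needed to know that the body has kept the counter at
      \<open>m\<close>.\<close>
    from wp_frame[OF this] have
      "wp W A c (\<lambda>g' t' out'. Q (g'(r := Suc m)) t' out' \<and> (\<forall>x. x \<notin> writes c \<longrightarrow> g' x = (g(r := m)) x)) (g(r := m)) t out"
      by simp
    from For.IH[OF r(3) bod IH(2) this]
    have "reach W A P (time ?n c + 2) (post ?n W Q (p + len (For r c))) (Suc p, X, out)"
    proof (rule reach_trans)
      fix c' assume "post ?n W (\<lambda>g' t' out'. Q (g'(r := Suc m)) t' out' \<and> (\<forall>x. x \<notin> writes c \<longrightarrow> g' x = (g(r := m)) x)) (Suc p + len c) c'"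
      then obtain g' t' X' out' where *: "c' = (Suc p + len c, X', out')" "corr ?n W g' t' X'"
        "Q (g'(r := Suc m)) t' out'" "g' r = m"
        using r(2) unfolding post_def by (cases c') auto
      have X': "X' r = m" "X' 2 = 1" "X' 0 = ?n"
        using *(4) corr_readable[OF *(2)] corr_const[OF *(2)] rr by auto
      \<comment> \<open>The new counter is at most \<open>n\<close>, and \<open>n\<close> itself is
        stored in cell 0.\<close>
      have "Suc m \<le> W" using IH(1) corr_bound[OF *(2), of 0] X' by simp
      then have s1: "step W A P c' = Some (Suc (Suc p) + len c, X'(r := Suc m), out')"
        using cc X' * by (simp add: step_def write_cell_def)
      have s2: "step W A P (Suc (Suc p) + len c, X'(r := Suc m), out') = Some (p + len (For r c), X'(r := Suc m), out')"
        using cd X' rr IH(1) by (simp add: step_def)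
      show "reach W A P 2 (post ?n W Q (p + len (For r c))) c'"
        unfolding numeral_2_eq_2 by (rule reach_step[OF s1], rule reach_step_post[OF s2])
         (use * corr_upd[OF *(2) r(1) \<open>Suc m \<le> W\<close>] in \<open>auto simp: post_def\<close>)
    qed
    then show ?case by simp
  next
    case IH: (Suc d m g t X out)
    have "wp W A c (loop (wp W A c) r (Suc m) (Suc d) Q) (g(r := m)) t out" using IH.prems by simp
    from wp_frame[OF this] have
      "wp W A c (\<lambda>g' t' out'. loop (wp W A c) r (Suc m) (Suc d) Q g' t' out' \<and> (\<forall>x. x \<notin> writes c \<longrightarrow> g' x = (g(r := m)) x)) (g(r := m)) t out" .
    from For.IH[OF r(3) bod IH.prems(2) this]
    have "reach W A P (time ?n c + Suc (Suc (Suc d * (time ?n c + 2)))) (post ?n W Q (p + len (For r c))) (Suc p, X, out)"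
    proof (rule reach_trans)
      fix c' assume "post ?n W (\<lambda>g' t' out'. loop (wp W A c) r (Suc m) (Suc d) Q g' t' out' \<and> (\<forall>x. x \<notin> writes c \<longrightarrow> g' x = (g(r := m)) x)) (Suc p + len c) c'"
      then obtain g' t' X' out' where *: "c' = (Suc p + len c, X', out')" "corr ?n W g' t' X'"
        "loop (wp W A c) r (Suc m) (Suc d) Q g' t' out'" "g' r = m"
        using r(2) unfolding post_def by (cases c') auto
      have X': "X' r = m" "X' 2 = 1" "X' 0 = ?n"
        using *(4) corr_readable[OF *(2)] corr_const[OF *(2)] rr by auto
      have Sm: "Suc m \<le> W" using IH.prems(1) corr_bound[OF *(2), of 0] X' by simp
      then have s1: "step W A P c' = Some (Suc (Suc p) + len c, X'(r := Suc m), out')"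
        using cc X' * by (simp add: step_def write_cell_def)
      have s2: "step W A P (Suc (Suc p) + len c, X'(r := Suc m), out') = Some (Suc p, X'(r := Suc m), out')"
        using cd X' rr IH.prems(1) by (simp add: step_def)
      show "reach W A P (Suc (Suc (Suc d * (time ?n c + 2)))) (post ?n W Q (p + len (For r c))) c'"
        by (rule reach_step[OF s1], rule reach_step[OF s2], rule IH.IH[of "Suc m" g' t'])
          (use IH.prems(1) *(3) corr_upd[OF *(2) r(1) Sm] in \<open>simp_all del: fun_upd_apply loop.simps\<close>)
    qed
    then show ?case by (simp add: algebra_simps)
  qed
  obtain d where d: "?n = Suc d" using A by (cases ?n) auto
  have s: "step W A P (p, X, out) = Some (Suc p, X(r := 0), out)"
    using ca by (simp add: step_def write_cell_def)
  have "reach W A P (Suc d * (time ?n c + 2)) (post ?n W Q (p + len (For r c))) (Suc p, X(r := 0), out)"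
    using For.prems(4) d by (intro iter[of 0 d g t] corr_upd For.prems(3) r) simp_all
  from reach_step[OF s this] show ?case using d by simp
qed


section \<open>The algorithm\<close>

lemma wp_weaken:
  assumes "wp W A c Q g t out"
    and "\<And>g' t' out'. Q g' t' out' \<Longrightarrow> (\<And>x. x \<notin> writes c \<Longrightarrow> g' x = g x) \<Longrightarrow> Q' g' t' out'"
  shows "wp W A c Q' g t out"
  by (rule wp_mono[OF wp_frame[OF assms(1)]]) (use assms(2) in blast)

lemma wp_Seq: "wp W A (c ;; d) Q = wp W A c (wp W A d Q)"
  by (intro ext) simp

text \<open>
  Rows \<open>0, \<dots>, n\<close> of the table contain the counts \<open>card {l. l < j \<and> A ! l < A ! v}\<close>, row \<open>n + 1\<close> the
  labels and row \<open>n + 2\<close> the successors of the indices.  Register 5 always contains 0, register 6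
  contains \<open>s\<close>, register 9 the label of an index without successor, registers 10 and 11 contain
  \<open>n + 1\<close> and \<open>n + 2\<close>.  Register 20 tells whether an index with label at least \<open>k\<close> has been found;
  register 21 is the current index of the output phase.
\<close>

definition setup_cmd :: cmd where
  "setup_cmd = Times 7 1 1 ;; SetC 8 10 ;; Times 7 7 8 ;; Quot 6 0 7 ;; Plus 6 6 2 ;;
     Plus 10 0 2 ;; Plus 11 10 2 ;; SetC 8 2 ;; If_Less 6 8 (SetC 9 1) (SetC 9 0)"

text \<open>Register 12 holds the row \<open>j\<close>, register 13 holds \<open>j + 1\<close> and
  register 14 runs over the columns: the new row arises from the old one by a single comparison per
  entry.\<close>

definition count_row_cmd :: cmd where
  "count_row_cmd = For 14 (Get 15 12 14 ;; If_Less_Real 12 14 (Plus 15 15 2) Skip ;; Put 13 14 15)"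

definition count_cmd :: cmd where
  "count_cmd = For 12 (Plus 13 12 2 ;; count_row_cmd)"

text \<open>Registers 13, 14 and 15 hold \<open>i\<close>, \<open>i + 1\<close> and
  \<open>j\<close>; \<open>lo\<close> and \<open>hi\<close> name the corner of smaller and of larger
  value. Four table entries give the number of points inside, in register 17. A good pair whose
  label at \<open>j\<close> is not below that at \<open>i\<close> raises the latter and redirects
  its successor.\<close>

definition label_row_cmd :: "bool \<Rightarrow> cmd" where
  "label_row_cmd d = (let lo = (if d then 13 else 15); hi = (if d then 15 else 13) in
     For 15 (If_Less 13 15 (If_Less_Real lo hi
       (Get 16 15 lo ;; Get 17 15 hi ;; Get 18 14 lo ;; Get 19 14 hi ;;
        Minus 17 17 19 ;; Minus 16 16 18 ;; Minus 17 17 16 ;; Plus 17 17 2 ;;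
        If_Less 17 6 Skip
          (Get 16 10 15 ;; Get 18 10 13 ;;
           If_Less 16 18 Skip (Plus 16 16 2 ;; Put 10 13 16 ;; Put 11 13 15)))
       Skip) Skip))"

definition label_cmd :: "bool \<Rightarrow> cmd" where
  "label_cmd d = For 12 (Minus 13 0 12 ;; Minus 13 13 2 ;; Plus 14 13 2 ;; Put 10 13 9 ;; label_row_cmd d)"

definition find_cmd :: cmd where
  "find_cmd = For 12 (Get 16 10 12 ;; If_Less 16 1 Skip (SetC 20 1 ;; Copy 21 12))"

text \<open>\<open>For\<close> has no early exit, so register 15 counts the points still to be
  output.\<close>

definition emit_block_cmd :: "bool \<Rightarrow> cmd" where
  "emit_block_cmd d = (let lo = (if d then 13 else 14); hi = (if d then 14 else 13) in
     For 16 (If_Less 5 15 (If_Less 13 16 (If_Less 16 14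
       (If_Less_Real lo 16 (If_Less_Real 16 hi (Emit 16 ;; Minus 15 15 2) Skip) Skip)
       Skip) Skip) Skip))"

text \<open>Only the first \<open>k\<close> of the \<open>n\<close> rounds act;
  \<open>k \<le> n\<close> ensures that all \<open>k\<close> blocks are output.\<close>

definition emit_cmd :: "bool \<Rightarrow> cmd" where
  "emit_cmd d = For 12 (If_Less 12 1
     (Copy 13 21 ;; Get 14 11 21 ;; Emit 13 ;; Minus 15 6 2 ;; emit_block_cmd d ;; Copy 21 14) Skip)"

definition pass_cmd :: "bool \<Rightarrow> cmd" where
  "pass_cmd d = label_cmd d ;; find_cmd ;; If_Less 5 20 (emit_cmd d) Skip"

definition main_cmd :: cmd where
  "main_cmd = setup_cmd ;; count_cmd ;; pass_cmd True ;; If_Less 5 20 Skip (pass_cmd False)"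

lemmas cmd_defs = setup_cmd_def count_row_cmd_def count_cmd_def label_row_cmd_def label_cmd_def
  find_cmd_def emit_block_cmd_def emit_cmd_def pass_cmd_def main_cmd_def Let_def

lemma writes_cmd:
  "writes count_row_cmd = {14, 15}" "writes count_cmd = {12, 13, 14, 15}"
  "writes (label_row_cmd d) = {15, 16, 17, 18, 19}"
  "writes (label_cmd d) = {12, 13, 14, 15, 16, 17, 18, 19}"
  "writes find_cmd = {12, 16, 20, 21}" "writes (emit_block_cmd d) = {15, 16}"
  by (auto simp: cmd_defs)

lemma wf_main_cmd: "wf_cmd main_cmd"
  by (simp add: cmd_defs readable_def writable_def nregs_def)

lemma time_main_cmd: "time n main_cmd = 135 * n\<^sup>2 + 70 * n + 25"
  by (simp add: cmd_defs algebra_simps power2_eq_square)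

section \<open>Counting the points in a rectangle\<close>

definition cnt :: "real list \<Rightarrow> nat \<Rightarrow> nat \<Rightarrow> nat" where
  "cnt A j v = card {l. l < j \<and> A ! l < A ! v}"

lemma cnt_0 [simp]: "cnt A 0 v = 0" by (simp add: cnt_def)

lemma cnt_Suc: "cnt A (Suc j) v = cnt A j v + (if A ! j < A ! v then 1 else 0)"
proof -
  have "{l. l < Suc j \<and> A ! l < A ! v} = {l. l < j \<and> A ! l < A ! v} \<union> (if A ! j < A ! v then {j} else {})"
    by (auto simp: less_Suc_eq)
  then show ?thesis by (simp add: cnt_def)
qed

lemma cnt_le: "cnt A j v \<le> j"
  by (induction j) (auto simp: cnt_Suc)

text \<open>Two set differences of nested sets: first the positions up to \<open>i\<close> are
  removed, then the values below \<open>A ! u\<close>. Nestedness makes the truncated subtractions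
  exact.\<close>

lemma cnt_diff:
  assumes "i < j" "A ! u < A ! v"
  shows "(cnt A j v - cnt A (Suc i) v) - (cnt A j u - cnt A (Suc i) u) =
    card {l. i < l \<and> l < j \<and> A ! u \<le> A ! l \<and> A ! l < A ! v}"
proof -
  have d: "cnt A j w - cnt A (Suc i) w = card {l. i < l \<and> l < j \<and> A ! l < A ! w}" for w
  proof -
    have "{l. i < l \<and> l < j \<and> A ! l < A ! w} = {l. l < j \<and> A ! l < A ! w} - {l. l < Suc i \<and> A ! l < A ! w}"
      by auto
    moreover have "card ({l. l < j \<and> A ! l < A ! w} - {l. l < Suc i \<and> A ! l < A ! w}) =
        card {l. l < j \<and> A ! l < A ! w} - card {l. l < Suc i \<and> A ! l < A ! w}"
      by (rule card_Diff_subset) (use assms(1) in auto)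
    ultimately show ?thesis by (simp only: cnt_def)
  qed
  have "{l. i < l \<and> l < j \<and> A ! u \<le> A ! l \<and> A ! l < A ! v} =
    {l. i < l \<and> l < j \<and> A ! l < A ! v} - {l. i < l \<and> l < j \<and> A ! l < A ! u}"
    by auto
  moreover have "card ({l. i < l \<and> l < j \<and> A ! l < A ! v} - {l. i < l \<and> l < j \<and> A ! l < A ! u}) =
    card {l. i < l \<and> l < j \<and> A ! l < A ! v} - card {l. i < l \<and> l < j \<and> A ! l < A ! u}"
    by (rule card_Diff_subset) (use assms(2) in auto)
  ultimately show ?thesis by (simp only: d)
qed

text \<open>Here \<open>u\<close> is the corner of smaller value. Distinctness turns the half-open
  range of \<open>cnt_diff\<close> into the open one.\<close>

lemma card_inside:
  assumes A: "distinct A" and ij: "i < j" "j < length A" "before d (A ! i) (A ! j)"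
  defines "u \<equiv> if d then i else j" and "v \<equiv> if d then j else i"
  shows "card {l. inside d A i j l} = (cnt A j v - cnt A (Suc i) v) - (cnt A j u - cnt A (Suc i) u)"
proof -
  have lt: "A ! u < A ! v" using ij by (auto simp: u_def v_def before_def)
  have ne: "A ! i \<noteq> A ! l \<and> A ! l \<noteq> A ! j" if "i < l" "l < j" for l
    using that A ij by (auto simp: nth_eq_iff_index_eq)
  have "inside d A i j l \<longleftrightarrow> i < l \<and> l < j \<and> A ! u \<le> A ! l \<and> A ! l < A ! v" for l
    using ne[of l] by (cases d) (auto simp: inside_def before_def u_def v_def)
  then show ?thesis using cnt_diff[OF ij(1) lt] by simp
qed

section \<open>Labels by dynamic programming\<close>

text \<open>
  Loop invariant: all indices above \<open>m\<close> have been processed, and index \<open>m\<close> has been compared to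
  the indices below \<open>M\<close>.
\<close>

definition labelled :: "bool \<Rightarrow> real list \<Rightarrow> nat \<Rightarrow> nat \<Rightarrow> nat \<Rightarrow> nat \<Rightarrow> (nat \<Rightarrow> nat) \<Rightarrow> (nat \<Rightarrow> nat) \<Rightarrow> bool" where
  "labelled d A s b m M x nx \<longleftrightarrow>
     (\<forall>i. m \<le> i \<and> i < length A \<longrightarrow> b \<le> x i \<and> x i \<le> length A - i \<and>
        (x i = b \<or> good d A s i (nx i) \<and> x i = Suc (x (nx i)))) \<and>
     (\<forall>i j. m \<le> i \<and> (i = m \<longrightarrow> j < M) \<and> good d A s i j \<longrightarrow> x j < x i)"

lemma good_less: "good d A s i j \<Longrightarrow> i < j \<and> j < length A"
  by (simp add: good_def)

lemma labelledD:
  assumes "labelled d A s b m M x nx" "m \<le> i" "i < length A"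
  shows "b \<le> x i" "x i \<le> length A - i" "x i = b \<or> good d A s i (nx i) \<and> x i = Suc (x (nx i))"
  using assms unfolding labelled_def by blast+

lemma labelled_less:
  "labelled d A s b m M x nx \<Longrightarrow> m \<le> i \<Longrightarrow> (i = m \<Longrightarrow> j < M) \<Longrightarrow> good d A s i j \<Longrightarrow> x j < x i"
  unfolding labelled_def by blast

text \<open>Good pairs point to the right, so the label of \<open>i\<close> does not occur in any
  condition on larger indices.\<close>

lemma labelled_init:
  assumes L: "labelled d A s b (Suc i) (length A) x nx" and i: "i < length A" "b \<le> 1"
  shows "labelled d A s b i 0 (x(i := b)) nx"
  unfolding labelled_def
proof (intro conjI allI impI; elim conjE)
  fix l assume l: "i \<le> l" "l < length A"
  have "b \<le> (x(i := b)) l \<and> (x(i := b)) l \<le> length A - l \<and>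
    ((x(i := b)) l = b \<or> good d A s l (nx l) \<and> (x(i := b)) l = Suc ((x(i := b)) (nx l)))"
  proof (cases "l = i")
    case True
    then show ?thesis using i by auto
  next
    case False
    then have "Suc i \<le> l" using l by simp
    from labelledD[OF L this l(2)] show ?thesis using False l good_less[of d A s l "nx l"] by auto
  qed
  then show "b \<le> (x(i := b)) l" "(x(i := b)) l \<le> length A - l"
    "(x(i := b)) l = b \<or> good d A s l (nx l) \<and> (x(i := b)) l = Suc ((x(i := b)) (nx l))" by auto
next
  fix l j assume l: "i \<le> l" "l = i \<longrightarrow> j < 0" "good d A s l j"
  then have "Suc i \<le> l" by (cases "l = i") auto
  moreover have "l < j" "j < length A" using good_less[OF l(3)] by auto
  ultimately show "(x(i := b)) j < (x(i := b)) l"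
    using labelled_less[OF L _ _ l(3)] by auto
qed

lemma labelled_skip:
  assumes L: "labelled d A s b i j x nx" and "\<not> (good d A s i j \<and> x i \<le> x j)"
  shows "labelled d A s b i (Suc j) x nx"
proof -
  have "x j' < x l" if "i \<le> l" "l = i \<longrightarrow> j' < Suc j" "good d A s l j'" for l j'
    using labelled_less[OF L that(1) _ that(3)] that assms(2) less_SucE not_le by metis
  then show ?thesis using L unfolding labelled_def by blast
qed

text \<open>As \<open>x i \<le> x j\<close>, the label of \<open>i\<close> only grows, and the
  comparisons made earlier at \<open>i\<close> remain satisfied.\<close>

lemma labelled_update:
  assumes L: "labelled d A s b i j x nx" and g: "good d A s i j" and le: "x i \<le> x j"
  shows "labelled d A s b i (Suc j) (x(i := Suc (x j))) (nx(i := j))"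
  unfolding labelled_def
proof (intro conjI allI impI; elim conjE)
  have ij: "i < j" "j < length A" using good_less[OF g] by auto
  let ?x = "x(i := Suc (x j))" and ?nx = "nx(i := j)"
  {
    fix l assume l: "i \<le> l" "l < length A"
    have "b \<le> ?x l \<and> ?x l \<le> length A - l \<and> (?x l = b \<or> good d A s l (?nx l) \<and> ?x l = Suc (?x (?nx l)))"
    proof (cases "l = i")
      case True
      have "b \<le> x i" "x j \<le> length A - j" 
        using labelledD(1)[OF L order_refl] labelledD(2)[OF L _ ij(2)] ij by auto
      then show ?thesis using True ij le g by auto
    next
      case False
      then show ?thesis using labelledD[OF L l] l good_less[of d A s l "nx l"] by auto
    qed
    then show "b \<le> ?x l" "?x l \<le> length A - l" "?x l = b \<or> good d A s l (?nx l) \<and> ?x l = Suc (?x (?nx l))"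
      by auto
  next
    fix l j' assume l: "i \<le> l" "l = i \<longrightarrow> j' < Suc j" "good d A s l j'"
    have j': "l < j'" "j' < length A" using good_less[OF l(3)] by auto
    show "?x j' < ?x l"
    proof (cases "l = i \<and> j' = j")
      case True
      then show ?thesis using j' by simp
    next
      case False
      then have "x j' < x l" by (intro labelled_less[OF L l(1) _ l(3)]) (use l in auto)
      then show ?thesis using False j' l le by auto
    qed
  }
qed

lemma le_of_pred_square_less:
  assumes "(k - 1)\<^sup>2 < (n :: nat)"
  shows "k \<le> n"
proof -
  have "k - 1 \<le> (k - 1)\<^sup>2" by (simp only: power2_eq_square le_square)
  then show ?thesis using assms by linarith
qed

section \<open>Correctness of the algorithm\<close>

locale block_search =
  fixes W :: nat and A :: "real list" and k s b :: nat
  assumes dist: "distinct A" and k: "0 < k" "(k - 1)\<^sup>2 < length A"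
    and W: "10 * k\<^sup>2 \<le> W" "10 \<le> W" "length A + 2 \<le> W"
    and s: "s = length A div (10 * k\<^sup>2) + 1"
    and b: "b = (if s = 1 then 1 else 0)"
begin

definition env :: "(nat \<Rightarrow> nat) \<Rightarrow> bool" where
  "env g \<longleftrightarrow> g 0 = length A \<and> g 1 = k \<and> g 2 = 1 \<and> g 5 = 0 \<and> g 6 = s \<and> g 9 = b \<and>
     g 10 = length A + 1 \<and> g 11 = length A + 2"

lemma env_cong: "env g \<Longrightarrow> (\<And>x. x \<in> {0, 1, 2, 5, 6, 9, 10, 11} \<Longrightarrow> g' x = g x) \<Longrightarrow> env g'"
  by (simp add: env_def)

definition counted :: "(nat \<Rightarrow> nat \<Rightarrow> nat) \<Rightarrow> bool" where
  "counted t \<longleftrightarrow> (\<forall>j v. j \<le> length A \<longrightarrow> v < length A \<longrightarrow> t j v = cnt A j v)"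

text \<open>The output loop also reads the successor of the last index, which may have none if
  \<open>s = 1\<close>. The entry is then 0 or left over from the first pass, and it must still be
  in range.\<close>

definition pointers_ok :: "(nat \<Rightarrow> nat \<Rightarrow> nat) \<Rightarrow> bool" where
  "pointers_ok t \<longleftrightarrow> (\<forall>i < length A. t (length A + 2) i < length A)"

lemma s_pos: "0 < s" by (simp add: s)

lemma s_le: "s \<le> length A + 1" by (simp add: s)

lemma k_le: "k \<le> length A"
  by (rule le_of_pred_square_less[OF k(2)])

lemma wp_setup:
  assumes "g 0 = length A" "g 1 = k" "g 2 = 1" "g 5 = 0"
  shows "wp W A setup_cmd (\<lambda>g' t' out'. env g' \<and> t' = t \<and> out' = out \<and> g' 20 = g 20) g t out"
proof -
  define q where "q = length A div (k * k * 10)"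
  have "k * k \<le> W" "k * k * 10 \<le> W" using W(1) by (auto simp: power2_eq_square)
  moreover have "s = q + 1" by (simp add: s q_def power2_eq_square mult.commute)
  moreover have "q + 1 \<le> W" using s_le W(3) \<open>s = q + 1\<close> by linarith
  ultimately show ?thesis using assms W k(1)
    unfolding setup_cmd_def env_def by (simp add: b q_def[symmetric])
qed

lemma wp_count_row:
  assumes "g 12 = j" "g 13 = Suc j" "g 2 = 1" "j < length A"
    and t: "\<And>i v. i \<le> j \<Longrightarrow> v < length A \<Longrightarrow> t i v = cnt A i v"
  shows "wp W A count_row_cmd (\<lambda>g' t' out'. out' = out \<and> t' (length A + 2) = t (length A + 2) \<and>
    (\<forall>i v. i \<le> Suc j \<longrightarrow> v < length A \<longrightarrow> t' i v = cnt A i v)) g t out"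
  unfolding count_row_cmd_def
proof (rule wp_For[where I = "\<lambda>m g' t' out'. out' = out \<and> t' (length A + 2) = t (length A + 2) \<and>
    (\<forall>i v. i \<le> j \<longrightarrow> v < length A \<longrightarrow> t' i v = cnt A i v) \<and> (\<forall>v<m. t' (Suc j) v = cnt A (Suc j) v)"],
    goal_cases)
  case 1
  show ?case using t by simp
next
  case (2 m g' t' out')
  have "g' 12 = j" "g' 13 = Suc j" "g' 2 = 1" using 2(3)[of 12] 2(3)[of 13] 2(3)[of 2] assms by auto
  moreover have "cnt A j m + 1 \<le> W" using cnt_le[of A j m] assms(4) W(3) by linarith
  ultimately show ?case using 2(1,2) assms(4) by (auto simp: cnt_Suc less_Suc_eq)
next
  case (3 g' t' out')
  then show ?case by (auto simp: le_Suc_eq)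
qed

lemma wp_count:
  assumes "env g" and t: "\<And>i v. t i v = 0"
  shows "wp W A count_cmd (\<lambda>g' t' out'. counted t' \<and> out' = out \<and> pointers_ok t') g t out"
  unfolding count_cmd_def
\<comment> \<open>The successor row is tracked because its initial zeros establish
  \<open>pointers_ok\<close>.\<close>
proof (rule wp_For[where I = "\<lambda>m g' t' out'. out' = out \<and> t' (length A + 2) = t (length A + 2) \<and>
    (\<forall>i v. i \<le> m \<longrightarrow> v < length A \<longrightarrow> t' i v = cnt A i v)"], goal_cases)
  case 1
  show ?case using t by simp
next
  case (2 m g' t' out')
  have g: "g' 2 = 1" using 2(3)[of 2] assms(1) by (simp add: writes_cmd env_def)
  have "wp W A count_row_cmd (\<lambda>g'' t'' out''. out'' = out' \<and> t'' (length A + 2) = t' (length A + 2) \<and>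
    (\<forall>i v. i \<le> Suc m \<longrightarrow> v < length A \<longrightarrow> t'' i v = cnt A i v)) (g'(12 := m, 13 := Suc m)) t' out'"
    by (rule wp_count_row) (use 2 g in auto)
  then show ?case using 2(1,2) g W(3) by simp
next
  case (3 g' t' out')
  then show ?case using t by (auto simp: counted_def pointers_ok_def)
qed

definition labels_state :: "bool \<Rightarrow> nat \<Rightarrow> nat \<Rightarrow> (nat \<Rightarrow> nat \<Rightarrow> nat) \<Rightarrow> bool" where
  "labels_state d m M t \<longleftrightarrow> counted t \<and> pointers_ok t \<and>
     labelled d A s b m M (t (length A + 1)) (t (length A + 2))"

lemma wp_label_row:
  assumes "env g" and i: "i < length A" "g 13 = i" "g 14 = Suc i"
    and t: "labels_state d i 0 t"
  shows "wp W A (label_row_cmd d) (\<lambda>g' t' out'. out' = out \<and> labels_state d i (length A) t') g t out"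
  unfolding label_row_cmd_def Let_def
proof (rule wp_For[where I = "\<lambda>m g' t' out'. out' = out \<and> labels_state d i m t'"], goal_cases)
  case 1
  show ?case using t by simp
next
  case (2 j g' t' out')
  let ?n = "length A"
  let ?x = "t' (?n + 1)" and ?nx = "t' (?n + 2)"
  let ?u = "if d then i else j" and ?v = "if d then j else i"
  have env: "env g'" using assms(1) by (rule env_cong) (use 2(3) in auto)
  have g: "g' 13 = i" "g' 14 = Suc i" using 2(3)[of 13] 2(3)[of 14] i by auto
  from 2(2) have out: "out' = out" and C: "counted t'" and P: "pointers_ok t'"
    and L: "labelled d A s b i j ?x ?nx" by (auto simp: labels_state_def)
  have skip: "labels_state d i (Suc j) t'" if "\<not> (good d A s i j \<and> ?x i \<le> ?x j)"
    using C P labelled_skip[OF L that] by (simp add: labels_state_def)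
  show ?case
  proof (cases "i < j \<and> A ! ?u < A ! ?v")
    case False
    then have "\<not> good d A s i j" by (auto simp: good_def before_def)
    then show ?thesis using False skip out i 2(1) g by (cases d) auto
  next
    case True
    have bef: "before d (A ! i) (A ! j)" using True by (cases d) (auto simp: before_def)
    define c where "c = card {l. inside d A i j l}"
    have c: "c = (cnt A j ?v - cnt A (Suc i) ?v) - (cnt A j ?u - cnt A (Suc i) ?u)"
      unfolding c_def using card_inside[OF dist _ 2(1) bef] True by simp
    have good: "good d A s i j \<longleftrightarrow> s \<le> c + 1" using bef True 2(1) by (simp add: good_def c_def)
    have "c \<le> j" using cnt_le[of A j ?v] unfolding c by linarith
    then have cW: "c + 1 \<le> W" using 2(1) W(3) by linarith
    have T: "t' j w = cnt A j w" "t' (Suc i) w = cnt A (Suc i) w" if "w < ?n" for w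
      using C that i 2(1) by (auto simp: counted_def)
    \<comment> \<open>The bound on labels in \<open>labelled\<close> serves to keep the incremented
      label within a word.\<close>
    have "?x j \<le> ?n - j" using labelledD(2)[OF L _ 2(1)] True by simp
    then have xW: "?x j + 1 \<le> W" using W(3) by linarith
    have upd: "labels_state d i (Suc j) (t'(?n + 1 := ?x(i := Suc (?x j)), ?n + 2 := ?nx(i := j)))"
      if "good d A s i j" "?x i \<le> ?x j"
      using C P labelled_update[OF L that] 2(1) by (simp add: labels_state_def counted_def pointers_ok_def)
    show ?thesis
    proof (cases "good d A s i j \<and> ?x i \<le> ?x j")
      case False
      then show ?thesis
        using True skip[OF False] out i 2(1) g env cW T c good
        by (cases d) (auto simp: env_def)
    next
      case good': True
      then show ?thesis
        using True upd out i 2(1) g env cW xW T c good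
        by (cases d) (auto simp: env_def)
    qed
  qed
next
  case (3 g' t' out')
  then show ?case by simp
qed

lemma wp_label:
  assumes "env g" and t: "counted t" "pointers_ok t"
  shows "wp W A (label_cmd d) (\<lambda>g' t' out'. out' = out \<and> labels_state d 0 (length A) t') g t out"
  unfolding label_cmd_def
proof (rule wp_For[where I = "\<lambda>m g' t' out'. out' = out \<and> labels_state d (length A - m) (length A) t'"],
    goal_cases)
  case 1
  show ?case using t by (auto simp: labels_state_def labelled_def dest: good_less)
next
  case (2 m g' t' out')
  let ?n = "length A"
  \<comment> \<open>Round \<open>m\<close> treats the indices from right to left: the processed
    range grows from \<open>Suc i\<close> down to \<open>i\<close>.\<close>
  define i where "i = ?n - Suc m"
  have env: "env g'" using assms(1) by (rule env_cong) (use 2(3) in \<open>auto simp: writes_cmd\<close>)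
  have i: "i < ?n" "?n - m = Suc i" using 2(1) by (auto simp: i_def)
  let ?t = "t'(?n + 1 := (t' (?n + 1))(i := b))"
  have "b \<le> 1" by (simp add: b)
  then have "labels_state d i 0 ?t"
    using 2(2) labelled_init[of d A s b i "t' (?n + 1)"] i
    by (simp add: labels_state_def counted_def pointers_ok_def)
  then have "wp W A (label_row_cmd d) (\<lambda>g'' t'' out''. out'' = out' \<and> labels_state d i ?n t'')
      (g'(12 := m, 13 := i, 14 := Suc i)) ?t out'"
    by (intro wp_label_row) (use i env in \<open>auto simp: env_def\<close>)
  moreover have "length A - Suc m = i" by (simp add: i_def)
  ultimately show ?case using 2(2) env i W(3) by (simp add: env_def)
next
  case (3 g' t' out')
  then show ?case by simp
qed

lemma wp_find:
  assumes "env g" "g 20 = 0"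
  shows "wp W A find_cmd (\<lambda>g' t' out'. out' = out \<and> t' = t \<and>
    ((g' 20 = 0 \<and> (\<forall>i<length A. t (length A + 1) i < k)) \<or>
     (g' 20 = 1 \<and> g' 21 < length A \<and> k \<le> t (length A + 1) (g' 21)))) g t out"
  unfolding find_cmd_def
proof (rule wp_For[where I = "\<lambda>m g' t' out'. out' = out \<and> t' = t \<and>
    ((g' 20 = 0 \<and> (\<forall>i<m. t (length A + 1) i < k)) \<or>
     (g' 20 = 1 \<and> g' 21 < length A \<and> k \<le> t (length A + 1) (g' 21)))"], goal_cases)
  case 1
  show ?case using assms by simp
next
  case (2 m g' t' out')
  have env: "env g'" using assms(1) by (rule env_cong) (use 2(3) in auto)
  show ?case using 2(1,2) env W by (auto simp: env_def less_Suc_eq)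
next
  case (3 g' t' out')
  then show ?case by simp
qed

lemma wp_emit_block:
  assumes "env g" and "g 13 = i" "g 14 = j" "g 15 = s - 1" "i < length A" "j < length A"
  shows "wp W A (emit_block_cmd d) (\<lambda>g' t' out'. t' = t \<and>
    out' = out @ map ((!) A) (take (s - 1) (filter (inside d A i j) [0..<length A]))) g t out"
proof -
  \<comment> \<open>The candidates seen before position \<open>m\<close>. In the invariant below,
    truncated subtraction keeps register 15 at 0 once \<open>s - 1\<close> points have been
    output.\<close>
  define h where "h m = filter (inside d A i j) [0..<m]" for m
  have "wp W A (emit_block_cmd d) (\<lambda>g' t' out'. t' = t \<and>
    out' = out @ map ((!) A) (take (s - 1) (h (length A)))) g t out"
    unfolding emit_block_cmd_def Let_def
  proof (rule wp_For[where I = "\<lambda>m g' t' out'. t' = t \<and>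
      out' = out @ map ((!) A) (take (s - 1) (h m)) \<and> g' 15 = s - 1 - length (h m)"], goal_cases)
    case 1
    show ?case using assms by (simp add: h_def)
  next
    case (2 l g' t' out')
    have env: "env g'" using assms(1) by (rule env_cong) (use 2(3) in auto)
    have g: "g' 13 = i" "g' 14 = j" using 2(3)[of 13] 2(3)[of 14] assms by auto
    have eq: "inside d A i j l \<longleftrightarrow>
        i < l \<and> l < j \<and> A ! (if d then i else j) < A ! l \<and> A ! l < A ! (if d then j else i)"
      by (auto simp: inside_def before_def)
    show ?case
    proof (cases "inside d A i j l")
      case True
      then have h: "h (Suc l) = h l @ [l]" by (simp add: h_def)
      show ?thesis
      proof (cases "length (h l) < s - 1")
        case less: True
        then have "take (s - 1) (h (Suc l)) = take (s - 1) (h l) @ [l]" by (simp add: h)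
        then show ?thesis using 2(1,2) env g assms(5,6) True[unfolded eq] less h
          by (cases d) (simp_all add: env_def)
      next
        case False
        then have "take (s - 1) (h (Suc l)) = take (s - 1) (h l)" "s - 1 - length (h l) = 0"
          "s - 1 - length (h (Suc l)) = 0" by (simp_all add: h)
        then show ?thesis using 2(1,2) env by (simp add: env_def)
      qed
    next
      case False
      then have "h (Suc l) = h l" by (simp add: h_def)
      then show ?thesis using 2(1,2) env g assms(5,6) False[unfolded eq]
        by (cases d) (auto simp: env_def)
    qed
  next
    case (3 g' t' out')
    then show ?case by simp
  qed
  then show ?thesis by (simp add: h_def)
qed

lemma wp_emit:
  assumes "env g" and "g 21 = i" "i < length A" "pointers_ok t"
  shows "wp W A (emit_cmd d) (\<lambda>g' t' out'. 
    out' = out @ map ((!) A) (concat (blocks d A s (t (length A + 2)) i k))) g t out"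
  unfolding emit_cmd_def
\<comment> \<open>\<open>min m k\<close> freezes the invariant after the first \<open>k\<close>
  rounds.\<close>
proof (rule wp_For[where I = "\<lambda>m g' t' out'. t' = t \<and>
    out' = out @ map ((!) A) (concat (blocks d A s (t (length A + 2)) i (min m k))) \<and>
    g' 21 = (t (length A + 2) ^^ (min m k)) i \<and> g' 21 < length A"], goal_cases)
  case 1
  show ?case using assms by simp
next
  case (2 m g' t' out')
  let ?nx = "t (length A + 2)"
  have env: "env g'" using assms(1) by (rule env_cong) (use 2(3) in \<open>auto simp: writes_cmd\<close>)
  show ?case
  proof (cases "m < k")
    case False
    then show ?thesis using 2 env by (simp add: env_def min_def)
  next
    case True
    define p where "p = (?nx ^^ m) i"
    have p: "g' 21 = p" "p < length A" using 2(2) True by (auto simp: p_def)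
    have np: "?nx p < length A" using assms(4) p(2) by (simp add: pointers_ok_def)
    have "wp W A (emit_block_cmd d) (\<lambda>g'' t'' out''. t'' = t \<and> out'' = (out' @ [A ! p]) @
        map ((!) A) (take (s - 1) (filter (inside d A p (?nx p)) [0..<length A])))
      (g'(12 := m, 13 := p, 14 := ?nx p, 15 := s - 1)) t (out' @ [A ! p])"
      by (rule wp_emit_block) (use env p np in \<open>auto simp: env_def\<close>)
    then have "wp W A (emit_block_cmd d) (wp W A (Copy 21 14) (\<lambda>g'' t'' out''. t'' = t \<and>
        out'' = out @ map ((!) A) (concat (blocks d A s ?nx i (min (Suc m) k))) \<and>
        g'' 21 = (?nx ^^ (min (Suc m) k)) i \<and> g'' 21 < length A))
      (g'(12 := m, 13 := p, 14 := ?nx p, 15 := s - 1)) t (out' @ [A ! p])"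
    proof (rule wp_weaken, goal_cases)
      case (1 g'' t'' out'')
      have "g'' 14 = ?nx p" using 1(2)[of 14] by (simp add: writes_cmd)
      then show ?case using 1(1) 2(2) True np
        by (simp add: blocks_Suc block_def p_def del: blocks.simps)
    qed
    then show ?thesis using True env p 2(1,2) by (simp add: env_def)
  qed
next
  case (3 g' t' out')
  then show ?case using k_le by (simp add: min_def)
qed

definition solution :: "real list \<Rightarrow> bool" where
  "solution B \<longleftrightarrow> subseq B A \<and> block_monotone k s B"

text \<open>The labels are quantified existentially because the second pass overwrites those of the
  first, while the contradiction needs both.\<close>

definition failed :: "bool \<Rightarrow> bool" where
  "failed d \<longleftrightarrow> (\<exists>x. (\<forall>i<length A. x i < k \<and> b \<le> x i) \<and> (\<forall>i j. good d A s i j \<longrightarrow> x j < x i))"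

lemma solution_blocks:
  assumes L: "labelled d A s b 0 (length A) x nx" and i: "i < length A" "k \<le> x i"
  shows "solution (map ((!) A) (concat (blocks d A s nx i k)))"
proof -
  have "chain d A s (blocks d A s nx i k)"
  proof (rule conjunct1[OF chain_blocks[of s i A k x d nx]])
    \<comment> \<open>The base label \<open>b\<close> is 0, or it is 1 and \<open>s = 1\<close>;
      these are the first two alternatives.\<close>
    show "x l = 0 \<or> x l = 1 \<and> s = 1 \<or> good d A s l (nx l) \<and> x l = Suc (x (nx l))" if "l < length A" for l
      using labelledD(3)[OF L _ that] by (simp add: b split: if_splits)
  qed (use s_pos i in auto)
  moreover have "blocks d A s nx i k \<noteq> []" using k(1) by (metis length_blocks list.size(3) less_irrefl)
  ultimately show ?thesis
    using chain_block_monotone[OF dist s_pos, of d "blocks d A s nx i k"] by (simp add: solution_def)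
qed

lemma wp_pass:
  assumes "env g" "g 20 = 0" "counted t" "pointers_ok t"
  shows "wp W A (pass_cmd d) (\<lambda>g' t' out'.
    (g' 20 = 0 \<and> env g' \<and> counted t' \<and> pointers_ok t' \<and> out' = out \<and> failed d) \<or>
    (g' 20 = 1 \<and> (\<exists>B. out' = out @ B \<and> solution B))) g t out" (is "wp W A _ ?Q g t out")
proof -
  have "wp W A (label_cmd d) (wp W A find_cmd (wp W A (If_Less 5 20 (emit_cmd d) Skip) ?Q)) g t out"
  proof (rule wp_weaken[OF wp_label[OF assms(1,3,4)]], elim conjE)
    fix g1 t1 out1
    assume *: "\<And>x. x \<notin> writes (label_cmd d) \<Longrightarrow> g1 x = g x" "out1 = out" "labels_state d 0 (length A) t1"
    have env: "env g1" using assms(1) by (rule env_cong) (use *(1) in \<open>auto simp: writes_cmd\<close>)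
    have g20: "g1 20 = 0" using *(1)[of 20] assms(2) by (simp add: writes_cmd)
    from *(3) have C: "counted t1" and P: "pointers_ok t1"
      and L: "labelled d A s b 0 (length A) (t1 (length A + 1)) (t1 (length A + 2))"
      by (auto simp: labels_state_def)
    show "wp W A find_cmd (wp W A (If_Less 5 20 (emit_cmd d) Skip) ?Q) g1 t1 out1"
    proof (rule wp_weaken[OF wp_find[OF env g20]], elim conjE)
      fix g2 t2 out2
      assume **: "\<And>x. x \<notin> writes find_cmd \<Longrightarrow> g2 x = g1 x" "out2 = out1" "t2 = t1"
        "(g2 20 = 0 \<and> (\<forall>i<length A. t1 (length A + 1) i < k)) \<or>
         (g2 20 = 1 \<and> g2 21 < length A \<and> k \<le> t1 (length A + 1) (g2 21))"
      have env2: "env g2" using env by (rule env_cong) (use **(1) in \<open>auto simp: writes_cmd\<close>)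
      from **(4) show "wp W A (If_Less 5 20 (emit_cmd d) Skip) ?Q g2 t2 out2"
      proof (elim disjE conjE)
        assume f: "g2 20 = 0" "\<forall>i<length A. t1 (length A + 1) i < k"
        have "failed d" unfolding failed_def
        proof (intro exI[of _ "t1 (length A + 1)"] conjI allI impI)
          fix i j assume "good d A s i j"
          then show "t1 (length A + 1) j < t1 (length A + 1) i"
            using labelled_less[OF L _ _ \<open>good d A s i j\<close>] good_less by blast
        qed (use f(2) labelledD(1)[OF L] in auto)
        then have "?Q g2 t2 out2" using f(1) env2 **(2,3) *(2) C P by blast
        then show ?thesis using f(1) env2 by (simp add: env_def)
      next
        assume f: "g2 20 = 1" "g2 21 < length A" "k \<le> t1 (length A + 1) (g2 21)"
        have "wp W A (emit_cmd d) ?Q g2 t2 out2"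
        proof (rule wp_weaken[OF wp_emit[OF env2 refl f(2)]])
          show "pointers_ok t2" using P **(3) by simp
        next
          fix g3 t3 out3
          assume 3: "\<And>x. x \<notin> writes (emit_cmd d) \<Longrightarrow> g3 x = g2 x"
            "out3 = out2 @ map ((!) A) (concat (blocks d A s (t2 (length A + 2)) (g2 21) k))"
          have "g3 20 = 1" using 3(1)[of 20] f(1) by (simp add: emit_cmd_def writes_cmd)
          moreover have "solution (map ((!) A) (concat (blocks d A s (t2 (length A + 2)) (g2 21) k)))"
            using solution_blocks[OF L f(2,3)] **(3) by simp
          ultimately show "?Q g3 t3 out3" using 3(2) **(2) *(2) by blast
        qed
        then show ?thesis using f(1) env2 by (simp add: env_def)
      qed
    qed
  qed
  then show ?thesis by (simp only: pass_cmd_def wp_Seq)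
qed

text \<open>The labels of two failed passes would contradict \<open>exists_large_label\<close>; so
  if the increasing pass fails, the decreasing one succeeds.\<close>

lemma not_all_failed: "\<not> (failed True \<and> failed False)"
proof
  assume "failed True \<and> failed False"
  then have "\<exists>x. (\<forall>i<length A. x i < k \<and> b \<le> x i) \<and> (\<forall>i j. good d A s i j \<longrightarrow> x j < x i)" for d
    by (cases d) (auto simp: failed_def)
  then obtain x where x: "\<And>d. (\<forall>i<length A. x d i < k \<and> b \<le> x d i) \<and> (\<forall>i j. good d A s i j \<longrightarrow> x d j < x d i)"
    by metis
  have "\<exists>d i. i < length A \<and> k \<le> x d i"
    by (rule exists_large_label[OF dist k s]) (use x b in auto)
  then show False using x by (meson not_le)
qed

lemma wp_main:
  assumes "g 0 = length A" "g 1 = k" "g 2 = 1" "g 5 = 0" "g 20 = 0" "\<And>i v. t i v = 0"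
  shows "wp W A main_cmd (\<lambda>g' t' out'. solution out') g t []" (is "wp W A _ ?Q g t []")
proof -
  let ?fin = "If_Less 5 20 Skip (pass_cmd False)"
  have "wp W A setup_cmd (wp W A count_cmd (wp W A (pass_cmd True) (wp W A ?fin ?Q))) g t []"
  proof (rule wp_weaken[OF wp_setup[OF assms(1-4)]], elim conjE)
    fix g1 t1 and out1 :: "real list"
    assume 1: "env g1" "t1 = t" "out1 = []" "g1 20 = g 20"
    show "wp W A count_cmd (wp W A (pass_cmd True) (wp W A ?fin ?Q)) g1 t1 out1"
    proof (rule wp_weaken[OF wp_count[OF 1(1)]], simp add: 1 assms(6), elim conjE)
      fix g2 t2 out2
      assume 2: "\<And>x. x \<notin> writes count_cmd \<Longrightarrow> g2 x = g1 x" "counted t2" "out2 = out1" "pointers_ok t2"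
      have env: "env g2" using 1(1) by (rule env_cong) (use 2(1) in \<open>auto simp: writes_cmd\<close>)
      have g20: "g2 20 = 0" using 2(1)[of 20] 1 assms(5) by (simp add: writes_cmd)
      show "wp W A (pass_cmd True) (wp W A ?fin ?Q) g2 t2 out2"
      proof (rule wp_weaken[OF wp_pass[OF env g20 2(2,4)]])
        fix g3 t3 out3
        assume 3: "\<And>x. x \<notin> writes (pass_cmd True) \<Longrightarrow> g3 x = g2 x"
          "(g3 20 = 0 \<and> env g3 \<and> counted t3 \<and> pointers_ok t3 \<and> out3 = out2 \<and> failed True) \<or>
           (g3 20 = 1 \<and> (\<exists>B. out3 = out2 @ B \<and> solution B))"
        from 3(2) show "wp W A ?fin ?Q g3 t3 out3"
        proof (elim disjE conjE exE)
          assume f: "g3 20 = 0" "env g3" "counted t3" "pointers_ok t3" "out3 = out2" "failed True"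
          have "wp W A (pass_cmd False) ?Q g3 t3 out3"
            by (rule wp_weaken[OF wp_pass[OF f(2,1,3,4)]])
              (use f(5,6) not_all_failed 1(3) 2(3) in auto)
          then show ?thesis using f(1,2) by (simp add: env_def)
        next
          fix B assume f: "g3 20 = 1" "out3 = out2 @ B" "solution B"
          have "g3 5 = 0" 
            using 3(1)[of 5] env by (simp add: pass_cmd_def emit_cmd_def writes_cmd env_def)
          then show ?thesis using f 1(3) 2(3) by simp
        qed
      qed
    qed
  qed
  then show ?thesis by (simp only: main_cmd_def wp_Seq)
qed

end

section \<open>The machine program and the final bounds\<close>

definition program :: "instr list" where
  "program = Const 2 1 # Const 3 nregs # code 2 main_cmd @ [Halt]"

theorem program_correct:
  fixes A :: "real list"
  assumes A: "distinct A" and k: "0 < k" "(k - 1)\<^sup>2 < length A"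
  defines "s \<equiv> length A div (10 * k\<^sup>2) + 1"
  shows "\<exists>B. subseq B A \<and> block_monotone k s B \<and>
    computes_within program 10 k A B (230 * (length A)\<^sup>2 + 2)"
proof -
  let ?n = "length A"
  define W where "W = (?n + 1) ^ 10"
  have n: "0 < ?n" using k by linarith
  \<comment> \<open>Of the ten factors \<open>n + 1 \<ge> 2\<close> in \<open>W\<close>, seven
    supply the constant 128 and three remain to dominate the memory size and
    \<open>10 * k\<^sup>2\<close>.\<close>
  have Wge: "128 * (?n + 1) ^ 3 \<le> W"
  proof -
    have "2 ^ 7 \<le> (?n + 1) ^ 7" by (rule power_mono) (use n in linarith)+
    then have "2 ^ 7 * (?n + 1) ^ 3 \<le> (?n + 1) ^ 7 * (?n + 1) ^ 3" by (rule mult_le_mono1)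
    then show ?thesis by (simp add: W_def power_add[symmetric])
  qed
  have sq: "(?n + 1)\<^sup>2 \<le> (?n + 1) ^ 3" "?n + 1 \<le> (?n + 1) ^ 3" "1 \<le> (?n + 1) ^ 3"
    by (simp_all add: power_increasing self_le_power)
  have kn: "k \<le> ?n" by (rule le_of_pred_square_less[OF k(2)])
  have "k\<^sup>2 \<le> (?n + 1)\<^sup>2" by (rule power_mono) (use kn in auto)
  then have W: "10 * k\<^sup>2 \<le> W" "10 \<le> W" "?n + 2 \<le> W" using Wge sq by linarith+
  interpret block_search W A k s "if s = 1 then 1 else 0"
    by unfold_locales (use A k W in \<open>auto simp: s_def\<close>)
  have mem: "nregs + (?n + 3) * ?n \<le> W"
  proof -
    have "(?n + 3) * ?n \<le> 3 * (?n + 1)\<^sup>2" by (simp add: power2_eq_square algebra_simps)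
    then show ?thesis using Wge sq unfolding nregs_def by linarith
  qed
  let ?I = "(\<lambda>_. 0)(0 := ?n, 1 := k)" and ?X = "(\<lambda>_. 0)(0 := ?n, 1 := k, 2 := 1, 3 := nregs)"
  let ?t = "\<lambda>_ _. 0 :: nat"
  have corr: "corr ?n W ?X ?t ?X"
    using mem W kn by (auto simp: corr_def nregs_def)
  have wp: "wp W A main_cmd (\<lambda>g' t' out'. solution out') ?X ?t []"
    by (rule wp_main) auto
  have at: "code_at program 2 (code 2 main_cmd)"
    unfolding code_at_def program_def
    by (intro exI[of _ "[Const 2 1, Const 3 nregs]"] exI[of _ "[Halt]"]) simp
  from code_correct[OF n mem wf_main_cmd at corr wp]
  have "reach W A program (time ?n main_cmd) (post ?n W (\<lambda>g' t' out'. solution out') (2 + len main_cmd)) (2, ?X, [])" .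
  moreover have "step W A program (1, ?I(2 := 1), []) = Some (2, ?X, [])"
    using mem by (simp add: step_def program_def write_cell_def)
  moreover have "step W A program (0, ?I, []) = Some (1, ?I(2 := 1), [])"
    using W by (simp add: step_def program_def write_cell_def)
  ultimately have "reach W A program (Suc (Suc (time ?n main_cmd)))
      (post ?n W (\<lambda>g' t' out'. solution out') (2 + len main_cmd)) (initial_config k A)"
    unfolding initial_config_def by (intro reach_step)
  then obtain u X B where u: "u \<le> Suc (Suc (time ?n main_cmd))"
    "steps W A program u (initial_config k A) = Some (2 + len main_cmd, X, B)" "solution B"
    unfolding reach_def post_def by fastforce
  have "halted program (2 + len main_cmd, X, B)"
    by (simp add: halted_def program_def nth_append)
  \<comment> \<open>\<open>230 = 135 + 70 + 25\<close>, by \<open>n \<le> n\<^sup>2\<close> and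
    \<open>1 \<le> n\<^sup>2\<close>; the summand 2 pays for the two initial instructions.\<close>
  moreover have "u \<le> 230 * ?n\<^sup>2 + 2"
  proof -
    have "1 \<le> ?n" using n by linarith
    then have "?n \<le> ?n\<^sup>2" "1 \<le> ?n\<^sup>2" by (simp_all only: self_le_power one_le_power zero_less_numeral)
    then show ?thesis using u(1) unfolding time_main_cmd by linarith
  qed
  then have "real u \<le> real (230 * ?n\<^sup>2 + 2)" by (rule of_nat_mono)
  ultimately have "computes_within program 10 k A B (230 * ?n\<^sup>2 + 2)"
    unfolding computes_within_def
    by - (rule exI[of _ u], rule exI[of _ "2 + len main_cmd"], rule exI[of _ X],
      use u(2) in \<open>simp add: W_def\<close>)
  then show ?thesis using u(3) unfolding solution_def by blast
qed

lemma computes_within_mono: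
  assumes "computes_within P w k A B T" "T \<le> T'"
  shows "computes_within P w k A B T'"
proof -
  obtain t pc X where "real t \<le> T" "halted P (pc, X, B)"
    "steps ((length A + 1) ^ w) A P t (initial_config k A) = Some (pc, X, B)"
    using assms(1) unfolding computes_within_def by blast
  moreover from this have "real t \<le> T'" using assms(2) by linarith
  ultimately show ?thesis unfolding computes_within_def by blast
qed

theorem theorem1p1:
  shows "\<exists>c0 C0 :: real. c0 > 0 \<and> C0 > 0 \<and>
    (\<forall>(k :: nat) (n :: nat) (A :: real list).
       k > 0 \<and> n > 0 \<and> n > (k - 1)^2 \<and> length A = n \<and> distinct A \<longrightarrow>
       (\<exists>(s :: nat) B. real s \<ge> c0 * real n / (real k)^2 \<and>
          subseq B A \<and> block_monotone k s B)) \<and>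
    (\<exists>(P :: instr list) (w :: nat). \<forall>(k :: nat) (n :: nat) (A :: real list).
       k > 0 \<and> n > 0 \<and> n > (k - 1)^2 \<and> length A = n \<and> distinct A \<longrightarrow>
       (\<exists>(s :: nat) B. real s \<ge> c0 * real n / (real k)^2 \<and>
          subseq B A \<and> block_monotone k s B \<and>
          computes_within P w k A B (C0 * (real n)^2 * ln (real n + 1))))"
proof -
  \<comment> \<open>\<open>464 = 2 * 232\<close>: the time is at most
    \<open>232 * n\<^sup>2\<close>, and the factor 2 compensates for
    \<open>ln (n + 1) \<ge> 1 / 2\<close>.\<close>
  have main: "\<exists>s B. real s \<ge> 1 / 10 * real n / (real k)\<^sup>2 \<and> subseq B A \<and> block_monotone k s B \<and>
      computes_within program 10 k A B (464 * (real n)\<^sup>2 * ln (real n + 1))"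
    if "k > 0 \<and> n > 0 \<and> n > (k - 1)^2 \<and> length A = n \<and> distinct A" for k n and A :: "real list"
  proof -
    define s where "s = n div (10 * k\<^sup>2) + 1"
    have "\<exists>B. subseq B A \<and> block_monotone k s B \<and>
        computes_within program 10 k A B (real (230 * n\<^sup>2 + 2))"
      using program_correct[of A k] that by (simp add: s_def)
    then obtain B where B: "subseq B A" "block_monotone k s B"
      "computes_within program 10 k A B (real (230 * n\<^sup>2 + 2))" by blast
    \<comment> \<open>The summand 1 in \<open>s\<close> rounds the quotient up, which yields
      \<open>c0 = 1 / 10\<close>.\<close>
    have "n \<le> 10 * k\<^sup>2 * s"
    proof -
      have "n mod (10 * k\<^sup>2) < 10 * k\<^sup>2" using that by simp
      moreover have "10 * k\<^sup>2 * (n div (10 * k\<^sup>2)) + n mod (10 * k\<^sup>2) = n"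
        by (rule mult_div_mod_eq)
      ultimately show ?thesis unfolding s_def distrib_left by linarith
    qed
    then have "real n \<le> real (10 * k\<^sup>2 * s)" by (rule of_nat_mono)
    then have s: "real s \<ge> 1 / 10 * real n / (real k)\<^sup>2"
      using that by (simp add: divide_le_eq mult_ac)
    have "1 / 2 \<le> ln (real n + 1)"
    proof -
      \<comment> \<open>From \<open>ln y \<le> y - 1\<close> at \<open>y = 1 / 2\<close>.\<close>
      have "1 / 2 \<le> ln (2 :: real)" 
        using ln_le_minus_one[of "inverse 2 :: real"] by (simp add: ln_div)
      also have "\<dots> \<le> ln (real n + 1)" using that by simp
      finally show ?thesis .
    qed
    then have "464 * (real n)\<^sup>2 * (1 / 2) \<le> 464 * (real n)\<^sup>2 * ln (real n + 1)"
      by (intro mult_left_mono) auto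
    moreover have "1 \<le> (real n)\<^sup>2" using that by simp
    ultimately have "real (230 * n\<^sup>2 + 2) \<le> 464 * (real n)\<^sup>2 * ln (real n + 1)"
      by (simp add: algebra_simps)
    then have "computes_within program 10 k A B (464 * (real n)\<^sup>2 * ln (real n + 1))"
      by (rule computes_within_mono[OF B(3)])
    then show ?thesis using s B by blast
  qed
  show ?thesis
  proof (rule exI[of _ "1 / 10"], rule exI[of _ 464], intro conjI allI impI,
      goal_cases _ _ existence algorithm)
    case (existence k n A)
    then show ?case using main by blast
  next
    case algorithm
    show ?case by (rule exI[of _ program], rule exI[of _ 10]) (use main in blast)
  qed simp_all
qed

end
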